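(* Let $(X_k)_{k\ge 0}$ be a Markov chain taking values in a measurable space $(E,\mathcal{E})\subseteq\prod_{i\in I}(E^i,\mathcal{E}^i)$ contained in a countable product of measurable spaces. The following are equivalent. 1. $(X_k)_{k\ge 0}$ is locally mixing, that is, $\|\mathbf{P}^\mu-\mathbf{P}^\nu\|_{\mathcal{F}^J_{n,\infty}}\to 0$ as $n\to\infty$ for all $\mu,\nu\in\mathcal{P}(E)$ and all $J\subseteq I$ with $|J|<\infty$. 2. $\mathcal{A}_{\mathrm{loc}}$ is $\mathbf{P}^\mu$-trivial for every $\mu\in\mathcal{P}(E)$, that is, $\mathbf{P}^\mu(A)\in\{0,1\}$ for every $A\in\mathcal{A}_{\mathrm{loc}}$. 3. For every $J\subseteq I$ with $|J|<\infty$, there exists $\alpha>0$ such that for all $x,x'\in E$ there exists $n\ge 0$ such that $\|\mathbf{P}^x-\mathbf{P}^{x'}\|_{\mathcal{F}^J_{n,\infty}}\le 2-\alpha$.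
   Context: $I$ is a countable set, $(E^i,\mathcal{E}^i)$, $i\in I$, are measurable spaces, and $(E,\mathcal{E})\subseteq\prod_{i\in I}(E^i,\mathcal{E}^i)$ means that $E$ is a subset of the product carrying the trace of the product $\sigma$-field. Write $x=(x^i)_{i\in I}$ for $x\in E$ and $x^J=(x^i)_{i\in J}$ for $J\subseteq I$. $\Omega=E^{\mathbb{Z}}$, $X_k(\omega)=\omega(k)$ is the coordinate process, and $\mathcal{F}_+=\sigma\{X_k:k\ge 0\}$. $P:E\times\mathcal{E}\to[0,1]$ is the transition kernel of the chain, $\mathcal{P}(E)$ is the set of probability measures on $(E,\mathcal{E})$, and for $\mu\in\mathcal{P}(E)$, $\mathbf{P}^\mu$ is the probability measure on $\mathcal{F}_+$ under which $(X_k)_{k\ge 0}$ is Markov with transition kernel $P$ and initial law $X_0\sim\mu$; $\mathbf{P}^x=\mathbf{P}^{\delta_x}$. For $J\subseteq I$ and $m<n$ (with $n=\infty$ allowed), $\mathcal{F}^J_{m,n}=\sigma\{X_k^J:m\le k\le n\}$. The local tail $\sigma$-fields are $\mathcal{A}^J=\bigcap_{n\ge 0}\mathcal{F}^J_{n,\infty}$ and $\mathcal{A}_{\mathrm{loc}}=\bigvee_{|J|<\infty}\mathcal{A}^J$ (join over finite $J\subseteq I$). For probability measures $\mu,\nu$ and a $\sigma$-field $\mathcal{G}$, $\|\mu-\nu\|_{\mathcal{G}}=2\sup_{A\in\mathcal{G}}|\mu(A)-\nu(A)|$. *)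

theory Defs
  imports "HOL-Probability.Probability"
begin

(* E with the trace of the product sigma-field; E itself need not be measurable in the product. *)
definition state_space :: "'i set \<Rightarrow> ('i \<Rightarrow> 'a measure) \<Rightarrow> ('i \<Rightarrow> 'a) set \<Rightarrow> ('i \<Rightarrow> 'a) measure" where
  "state_space I M E = restrict_space (\<Pi>\<^sub>M i\<in>I. M i) E"

definition paths :: "'s measure \<Rightarrow> (int \<Rightarrow> 's) set" where
  "paths S = {\<omega>. \<forall>k. \<omega> k \<in> space S}"

(* The sigma-field on paths S generated by the N-valued maps f(X_k), k in T,
   where X_k is the k-th coordinate. *)
definition coord_field :: "'s measure \<Rightarrow> ('s \<Rightarrow> 'b) \<Rightarrow> 'b measure \<Rightarrow> int set \<Rightarrow> (int \<Rightarrow> 's) set set" where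
  "coord_field S f N T =
     sigma_sets (paths S) {{\<omega> \<in> paths S. f (\<omega> k) \<in> A} | k A. k \<in> T \<and> A \<in> sets N}"

definition path_field :: "'s measure \<Rightarrow> int set \<Rightarrow> (int \<Rightarrow> 's) set set" where
  "path_field S T = coord_field S (\<lambda>x. x) S T"

(* path_field S {0..} is F_+. Measures in HOL only carry values on their own sigma-field, so
   sets Q = F_+ makes Q a measure on F_+ in the literal sense. *)
definition is_markov_law ::
  "'s measure \<Rightarrow> ('s \<Rightarrow> 's measure) \<Rightarrow> 's measure \<Rightarrow> (int \<Rightarrow> 's) measure \<Rightarrow> bool" where
  "is_markov_law S K \<mu> Q \<longleftrightarrow>
     prob_space Q \<and> space Q = paths S \<and> sets Q = path_field S {0..} \<and>
     distr Q S (\<lambda>\<omega>. \<omega> 0) = \<mu> \<and>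
     (\<forall>n::nat. \<forall>A\<in>sets S.
        AE \<omega> in Q. real_cond_exp Q (sigma (paths S) (path_field S {0..int n}))
                     (indicator {\<omega> \<in> paths S. \<omega> (int n + 1) \<in> A}) \<omega>
                   = measure (K (\<omega> (int n))) A)"

(* Existence and uniqueness for K a Markov kernel on S and mu a probability measure on S
   is lemma is_markov_law_chain_law below. *)
definition chain_law :: "'s measure \<Rightarrow> ('s \<Rightarrow> 's measure) \<Rightarrow> 's measure \<Rightarrow> (int \<Rightarrow> 's) measure" where
  "chain_law S K \<mu> = (THE Q. is_markov_law S K \<mu> Q)"

definition local_field ::
  "('i \<Rightarrow> 'a measure) \<Rightarrow> ('i \<Rightarrow> 'a) measure \<Rightarrow> 'i set \<Rightarrow> int set \<Rightarrow> (int \<Rightarrow> 'i \<Rightarrow> 'a) set set" where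
  "local_field M S J T = coord_field S (\<lambda>x. restrict x J) (\<Pi>\<^sub>M i\<in>J. M i) T"

definition local_tail_field ::
  "('i \<Rightarrow> 'a measure) \<Rightarrow> ('i \<Rightarrow> 'a) measure \<Rightarrow> 'i set \<Rightarrow> (int \<Rightarrow> 'i \<Rightarrow> 'a) set set" where
  "local_tail_field M S J = (\<Inter>n::nat. local_field M S J {int n..})"

definition A_loc ::
  "'i set \<Rightarrow> ('i \<Rightarrow> 'a measure) \<Rightarrow> ('i \<Rightarrow> 'a) measure \<Rightarrow> (int \<Rightarrow> 'i \<Rightarrow> 'a) set set" where
  "A_loc I M S = sigma_sets (paths S) (\<Union>J\<in>{J. J \<subseteq> I \<and> finite J}. local_tail_field M S J)"

definition tv_dist :: "'w set set \<Rightarrow> 'w measure \<Rightarrow> 'w measure \<Rightarrow> real" where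
  "tv_dist G \<mu> \<nu> = 2 * (SUP A\<in>G. \<bar>measure \<mu> A - measure \<nu> A\<bar>)"

definition locally_mixing ::
  "'i set \<Rightarrow> ('i \<Rightarrow> 'a measure) \<Rightarrow> ('i \<Rightarrow> 'a) measure \<Rightarrow> (('i \<Rightarrow> 'a) \<Rightarrow> ('i \<Rightarrow> 'a) measure) \<Rightarrow> bool" where
  "locally_mixing I M S K \<longleftrightarrow>
     (\<forall>\<mu>\<in>space (prob_algebra S). \<forall>\<nu>\<in>space (prob_algebra S). \<forall>J. J \<subseteq> I \<and> finite J \<longrightarrow>
       (\<lambda>n::nat. tv_dist (local_field M S J {int n..}) (chain_law S K \<mu>) (chain_law S K \<nu>))
         \<longlonglongrightarrow> 0)"

lemma coord_gen_Pow:
  "{{\<omega> \<in> paths S. f (\<omega> k) \<in> A} | k A. k \<in> T \<and> A \<in> sets N} \<subseteq> Pow (paths S)"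
  by auto

lemma space_path_sigma [simp]: "space (sigma (paths S) (path_field S T)) = paths S"
  by (simp add: space_measure_of_conv)

lemma sets_path_sigma [simp]: "sets (sigma (paths S) (path_field S T)) = path_field S T"
proof -
  note G = coord_gen_Pow[of S "\<lambda>x. x" T S]
  have "path_field S T \<subseteq> Pow (paths S)"
    using sigma_sets_into_sp[OF G] by (auto simp: path_field_def coord_field_def)
  from sets_measure_of[OF this] show ?thesis
    unfolding path_field_def coord_field_def sigma_sets_sigma_sets_eq[OF G] .
qed

lemma coord_in_path_field: "k \<in> T \<Longrightarrow> A \<in> sets S \<Longrightarrow> {\<omega> \<in> paths S. \<omega> k \<in> A} \<in> path_field S T"
  unfolding path_field_def coord_field_def by (intro sigma_sets.Basic) blast

lemma path_field_mono: "T \<subseteq> U \<Longrightarrow> path_field S T \<subseteq> path_field S U"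
  unfolding path_field_def coord_field_def by (intro sigma_sets_mono') auto

lemma measurable_into_path_sigma:
  assumes "\<And>x. x \<in> space L \<Longrightarrow> g x \<in> paths S"
    and "\<And>k. k \<in> T \<Longrightarrow> (\<lambda>x. g x k) \<in> L \<rightarrow>\<^sub>M S"
  shows "g \<in> L \<rightarrow>\<^sub>M sigma (paths S) (path_field S T)"
proof -
  have "g \<in> L \<rightarrow>\<^sub>M sigma (paths S) {{\<omega> \<in> paths S. \<omega> k \<in> A} | k A. k \<in> T \<and> A \<in> sets S}"
  proof (rule measurable_measure_of)
    show "{{\<omega> \<in> paths S. \<omega> k \<in> A} | k A. k \<in> T \<and> A \<in> sets S} \<subseteq> Pow (paths S)" by auto
    show "g \<in> space L \<rightarrow> paths S" using assms(1) by auto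
    fix y assume "y \<in> {{\<omega> \<in> paths S. \<omega> k \<in> A} | k A. k \<in> T \<and> A \<in> sets S}"
    then obtain k A where y: "y = {\<omega> \<in> paths S. \<omega> k \<in> A}" and k: "k \<in> T" and A: "A \<in> sets S" by auto
    have "g -` y \<inter> space L = (\<lambda>x. g x k) -` A \<inter> space L"
      using assms(1) by (auto simp: y)
    then show "g -` y \<inter> space L \<in> sets L"
      using measurable_sets[OF assms(2)[OF k] A] by simp
  qed
  moreover have "sets (sigma (paths S) {{\<omega> \<in> paths S. \<omega> k \<in> A} | k A. k \<in> T \<and> A \<in> sets S})
      = sets (sigma (paths S) (path_field S T))"
    unfolding sets_path_sigma
    using sets_measure_of[OF coord_gen_Pow[of S "\<lambda>x. x" T S]]
    by (simp add: path_field_def coord_field_def)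
  ultimately show ?thesis
    using measurable_cong_sets by blast
qed

lemma measurable_coord:
  assumes "k \<in> T"
  shows "(\<lambda>\<omega>. \<omega> k) \<in> sigma (paths S) (path_field S T) \<rightarrow>\<^sub>M S"
proof (rule measurableI)
  fix A assume "A \<in> sets S"
  then have "{\<omega> \<in> paths S. \<omega> k \<in> A} \<in> path_field S T"
    using assms by (intro coord_in_path_field) auto
  moreover have "(\<lambda>\<omega>. \<omega> k) -` A \<inter> space (sigma (paths S) (path_field S T)) = {\<omega> \<in> paths S. \<omega> k \<in> A}"
    by auto
  ultimately show "(\<lambda>\<omega>. \<omega> k) -` A \<inter> space (sigma (paths S) (path_field S T)) \<in> sets (sigma (paths S) (path_field S T))"
    by simp
qed (simp add: space_path_sigma, simp add: paths_def)

lemma path_field_into_sp: "B \<in> path_field S T \<Longrightarrow> B \<subseteq> paths S"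
  using sets.sets_into_space[of B "sigma (paths S) (path_field S T)"] by simp

lemma path_field_determined:
  assumes "B \<in> path_field S T" "\<omega> \<in> paths S" "\<omega>' \<in> paths S" "\<And>k. k \<in> T \<Longrightarrow> \<omega> k = \<omega>' k"
  shows "\<omega> \<in> B \<longleftrightarrow> \<omega>' \<in> B"
  using assms(1) unfolding path_field_def coord_field_def
proof (induction rule: sigma_sets.induct)
  case (Basic a) then show ?case using assms by auto
next
  case (Compl a) then show ?case using assms by auto
qed auto

locale markov_law_setup =
  fixes S :: "'s measure" and K :: "'s \<Rightarrow> 's measure" and \<mu> :: "'s measure"
  assumes K: "K \<in> S \<rightarrow>\<^sub>M prob_algebra S" and \<mu>: "\<mu> \<in> space (prob_algebra S)"
begin

lemma K_sub [measurable]: "K \<in> S \<rightarrow>\<^sub>M subprob_algebra S"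
  using K by (rule measurable_prob_algebraD)

lemma K_prob: "x \<in> space S \<Longrightarrow> prob_space (K x)" "x \<in> space S \<Longrightarrow> sets (K x) = sets S"
  using measurable_space[OF K] by (auto simp: space_prob_algebra)

lemma mu_props: "prob_space \<mu>" "sets \<mu> = sets S"
  using \<mu> by (auto simp: space_prob_algebra)

lemma measurable_K_coord:
  assumes "A \<in> sets S" "k \<in> T"
  shows "(\<lambda>\<omega>. measure (K (\<omega> k)) A) \<in> borel_measurable (sigma (paths S) (path_field S T))"
  using measurable_compose[OF measurable_coord[OF assms(2)]
      measurable_compose[OF K_sub measurable_measure_subprob_algebra[OF assms(1)]]] .

lemma subalg:
  assumes "space Q = paths S" "sets Q = path_field S {0..}"
  shows "subalgebra Q (sigma (paths S) (path_field S {0..int n}))"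
  using assms path_field_mono[of "{0..int n}" "{0..}" S] by (auto simp: subalgebra_def)

(* The Markov property in integrated form. *)
lemma is_markov_law_iff:
  "is_markov_law S K \<mu> Q \<longleftrightarrow>
     prob_space Q \<and> space Q = paths S \<and> sets Q = path_field S {0..} \<and>
     distr Q S (\<lambda>\<omega>. \<omega> 0) = \<mu> \<and>
     (\<forall>n::nat. \<forall>A\<in>sets S. \<forall>B\<in>path_field S {0..int n}.
        measure Q (B \<inter> {\<omega> \<in> paths S. \<omega> (int n + 1) \<in> A})
        = (\<integral>\<omega>. indicator B \<omega> * measure (K (\<omega> (int n))) A \<partial>Q))"
proof -
  have "(AE \<omega> in Q. real_cond_exp Q (sigma (paths S) (path_field S {0..int n}))
                     (indicator {\<omega> \<in> paths S. \<omega> (int n + 1) \<in> A}) \<omega>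
                   = measure (K (\<omega> (int n))) A) \<longleftrightarrow>
        (\<forall>B\<in>path_field S {0..int n}.
        measure Q (B \<inter> {\<omega> \<in> paths S. \<omega> (int n + 1) \<in> A})
        = (\<integral>\<omega>. indicator B \<omega> * measure (K (\<omega> (int n))) A \<partial>Q))" (is "(AE \<omega> in Q. ?ce \<omega> = ?k \<omega>) \<longleftrightarrow> ?R")
    if Q: "prob_space Q" "space Q = paths S" "sets Q = path_field S {0..}" and A: "A \<in> sets S"
    for Q A and n :: nat
  proof -
    interpret prob_space Q by fact
    let ?F = "sigma (paths S) (path_field S {0..int n})"
    let ?C = "{\<omega> \<in> paths S. \<omega> (int n + 1) \<in> A}"
    interpret finite_measure_subalgebra Q ?F
      by standard (rule subalg[OF Q(2,3)])
    have C: "?C \<in> sets Q"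
      using A unfolding Q(3) by (intro coord_in_path_field) auto
    have kF: "?k \<in> borel_measurable ?F" by (rule measurable_K_coord) (use A in auto)
    have kQ [measurable]: "?k \<in> borel_measurable Q"
      by (rule measurable_from_subalg[OF subalg kF])
    have bd: "\<bar>?k \<omega>\<bar> \<le> 1" if "\<omega> \<in> space Q" for \<omega>
      using that K_prob[of "\<omega> (int n)"] by (auto simp: Q paths_def intro: prob_space.prob_le_1)
    have ik: "integrable Q ?k"
      by (rule integrable_const_bound[of _ 1]) (use bd in auto)
    have iC: "integrable Q (indicator ?C :: _ \<Rightarrow> real)"
      using C by (intro integrable_real_indicator) (auto simp: less_top[symmetric])
    have BQ: "B \<in> sets Q" if "B \<in> path_field S {0..int n}" for B
      using that subalg by (auto simp: subalgebra_def)
    have eqC: "set_lebesgue_integral Q B (indicator ?C :: _ \<Rightarrow> real) = measure Q (B \<inter> ?C)"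
      if "B \<in> path_field S {0..int n}" for B
      using BQ[OF that] C
      by (simp add: set_lebesgue_integral_def indicator_inter_arith[symmetric])
    show ?thesis
    proof
      assume ae: "AE \<omega> in Q. ?ce \<omega> = ?k \<omega>"
      show ?R
      proof
        fix B assume B: "B \<in> path_field S {0..int n}"
        have "measure Q (B \<inter> ?C) = set_lebesgue_integral Q B (indicator ?C :: _ \<Rightarrow> real)"
          using eqC[OF B] by simp
        also have "\<dots> = set_lebesgue_integral Q B ?ce"
          using real_cond_exp_intA[OF iC, of B] B by simp
        also have "\<dots> = (\<integral>\<omega>. indicator B \<omega> * ?k \<omega> \<partial>Q)"
          unfolding set_lebesgue_integral_def real_scaleR_def
          using ae BQ[OF B] by (intro integral_cong_AE) auto
        finally show "measure Q (B \<inter> ?C) = (\<integral>\<omega>. indicator B \<omega> * ?k \<omega> \<partial>Q)" .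
      qed
    next
      assume R: ?R
      show "AE \<omega> in Q. ?ce \<omega> = ?k \<omega>"
      proof (rule real_cond_exp_charact[OF _ iC ik kF])
        fix B assume "B \<in> sets ?F"
        then show "set_lebesgue_integral Q B (indicator ?C :: _ \<Rightarrow> real) = set_lebesgue_integral Q B ?k"
          using R eqC[of B] by (simp add: set_lebesgue_integral_def)
      qed
    qed
  qed
  then show ?thesis unfolding is_markov_law_def by (intro conj_cong refl) blast
qed

lemma markov_law_unique:
  assumes Q: "is_markov_law S K \<mu> Q" and Q': "is_markov_law S K \<mu> Q'"
  shows "Q = Q'"
proof -
  let ?F = "\<lambda>n::nat. sigma (paths S) (path_field S {0..int n})"
  note Qp = Q[unfolded is_markov_law_iff] and Qp' = Q'[unfolded is_markov_law_iff]
  interpret Q: prob_space Q using Qp by simp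
  interpret Q': prob_space Q' using Qp' by simp
  have sp: "space Q = paths S" "space Q' = paths S" and
    st: "sets Q = path_field S {0..}" "sets Q' = path_field S {0..}" using Qp Qp' by auto
  have coordm: "(\<lambda>\<omega>. \<omega> k) \<in> Q \<rightarrow>\<^sub>M S" "(\<lambda>\<omega>. \<omega> k) \<in> Q' \<rightarrow>\<^sub>M S" if "k \<ge> 0" for k
    using measurable_coord[of k "{0..}" S] that
      measurable_cong_sets[of Q "sigma (paths S) (path_field S {0..})" S S]
      measurable_cong_sets[of Q' "sigma (paths S) (path_field S {0..})" S S]
    by (simp_all add: st)
  have agree: "emeasure Q B = emeasure Q' B" if "B \<in> path_field S {0..int n}" for n B
    using that
  proof (induction n arbitrary: B)
    case 0
    have Bg: "path_field S {0..int 0} = {{\<omega> \<in> paths S. \<omega> 0 \<in> A} | A. A \<in> sets S}" (is "_ = ?G")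
    proof
      have "?G = {(\<lambda>\<omega>. \<omega> 0) -` A \<inter> paths S | A. A \<in> sets S}" by auto
      moreover have "\<dots> = sets (vimage_algebra (paths S) (\<lambda>\<omega>. \<omega> 0) S)"
        by (rule sets_vimage_algebra2[symmetric]) (auto simp: paths_def)
      ultimately have G: "?G = sets (vimage_algebra (paths S) (\<lambda>\<omega>. \<omega> 0) S)" by simp
      have "{{\<omega> \<in> paths S. \<omega> k \<in> A} | k A. k \<in> {0..int 0} \<and> A \<in> sets S} = ?G" by auto
      then show "path_field S {0..int 0} \<subseteq> ?G"
        using G sets.sigma_sets_eq[of "vimage_algebra (paths S) (\<lambda>\<omega>. \<omega> 0) S"]
        by (simp add: path_field_def coord_field_def)
    qed (auto intro!: coord_in_path_field)
    then obtain A where A: "A \<in> sets S" "B = {\<omega> \<in> paths S. \<omega> 0 \<in> A}" using 0 by auto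
    have "emeasure Q B = emeasure (distr Q S (\<lambda>\<omega>. \<omega> 0)) A"
      using A coordm[of 0] by (subst emeasure_distr) (auto simp: sp intro!: arg_cong[where f="emeasure Q"])
    also have "\<dots> = emeasure (distr Q' S (\<lambda>\<omega>. \<omega> 0)) A" using Qp Qp' by simp
    also have "\<dots> = emeasure Q' B"
      using A coordm[of 0] by (subst emeasure_distr) (auto simp: sp intro!: arg_cong[where f="emeasure Q'"])
    finally show ?case .
  next
    case (Suc n)
    let ?G = "{B \<inter> {\<omega> \<in> paths S. \<omega> (int n + 1) \<in> A} | B A. B \<in> path_field S {0..int n} \<and> A \<in> sets S}"
    have top: "paths S \<in> path_field S {0..int n}"
      using sets.top[of "?F n"] by simp
    have GP: "?G \<subseteq> Pow (paths S)" by auto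
    have gen: "path_field S {0..int (Suc n)} \<subseteq> sigma_sets (paths S) ?G"
      unfolding path_field_def[of S "{0..int (Suc n)}"] coord_field_def
    proof (rule sigma_sets_mono, safe)
      fix k A assume k: "k \<in> {0..int (Suc n)}" and A: "A \<in> sets S"
      show "{\<omega> \<in> paths S. \<omega> k \<in> A} \<in> sigma_sets (paths S) ?G"
      proof (cases "k = int n + 1")
        case True
        have "{\<omega> \<in> paths S. \<omega> k \<in> A} = paths S \<inter> {\<omega> \<in> paths S. \<omega> (int n + 1) \<in> A}"
          using True by auto
        then show ?thesis using top A by (intro sigma_sets.Basic) blast
      next
        case False
        then have "{\<omega> \<in> paths S. \<omega> k \<in> A} \<in> path_field S {0..int n}"
          using k A by (intro coord_in_path_field) auto
        moreover have "{\<omega> \<in> paths S. \<omega> k \<in> A} = {\<omega> \<in> paths S. \<omega> k \<in> A} \<inter> {\<omega> \<in> paths S. \<omega> (int n + 1) \<in> space S}"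
          by (auto simp: paths_def)
        ultimately show ?thesis by (intro sigma_sets.Basic) blast
      qed
    qed
    have Int: "Int_stable ?G"
    proof (rule Int_stableI, safe)
      fix B A B' A' assume "B \<in> path_field S {0..int n}" "A \<in> sets S" "B' \<in> path_field S {0..int n}" "A' \<in> sets S"
      then have "B \<inter> B' \<in> path_field S {0..int n}" "A \<inter> A' \<in> sets S"
        using sets.Int[of B "?F n" B'] by auto
      moreover have "B \<inter> {\<omega> \<in> paths S. \<omega> (int n + 1) \<in> A} \<inter> (B' \<inter> {\<omega> \<in> paths S. \<omega> (int n + 1) \<in> A'}) =
          (B \<inter> B') \<inter> {\<omega> \<in> paths S. \<omega> (int n + 1) \<in> A \<inter> A'}" by auto
      ultimately show "\<exists>B'' A''. B \<inter> {\<omega> \<in> paths S. \<omega> (int n + 1) \<in> A} \<inter> (B' \<inter> {\<omega> \<in> paths S. \<omega> (int n + 1) \<in> A'}) =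
          B'' \<inter> {\<omega> \<in> paths S. \<omega> (int n + 1) \<in> A''} \<and> B'' \<in> path_field S {0..int n} \<and> A'' \<in> sets S" by blast
    qed
    have restr: "restr_to_subalg Q (?F n) = restr_to_subalg Q' (?F n)"
      by (rule measure_eqI)
        (auto simp: sets_restr_to_subalg subalg sp st emeasure_restr_to_subalg Suc.IH)
    have eqG: "emeasure Q X = emeasure Q' X" if "X \<in> ?G" for X
    proof -
      from that obtain B A where X: "X = B \<inter> {\<omega> \<in> paths S. \<omega> (int n + 1) \<in> A}"
        and B: "B \<in> path_field S {0..int n}" and A: "A \<in> sets S" by auto
      have m: "(\<lambda>\<omega>. indicator B \<omega> * measure (K (\<omega> (int n))) A) \<in> borel_measurable (?F n)"
        using B A by (intro borel_measurable_times borel_measurable_indicator measurable_K_coord) auto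
      have "measure Q X = (\<integral>\<omega>. indicator B \<omega> * measure (K (\<omega> (int n))) A \<partial>Q)"
        unfolding X using Qp A B by blast
      also have "\<dots> = (\<integral>\<omega>. indicator B \<omega> * measure (K (\<omega> (int n))) A \<partial>Q')"
        using integral_subalgebra2[OF subalg m, of Q] integral_subalgebra2[OF subalg m, of Q'] restr
        by (simp add: sp st)
      also have "\<dots> = measure Q' X"
        unfolding X using Qp' A B by simp
      finally show ?thesis by (simp add: Q.emeasure_eq_measure Q'.emeasure_eq_measure)
    qed
    have GQ: "?G \<subseteq> path_field S {0..}"
    proof safe
      fix B A assume B: "B \<in> path_field S {0..int n}" and A: "A \<in> sets S"
      have "{\<omega> \<in> paths S. \<omega> (int n + 1) \<in> A} \<in> path_field S {0..}"
        using A by (intro coord_in_path_field) auto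
      moreover have "B \<in> path_field S {0..}" using B path_field_mono[of "{0..int n}" "{0..}" S] by auto
      ultimately show "B \<inter> {\<omega> \<in> paths S. \<omega> (int n + 1) \<in> A} \<in> path_field S {0..}"
        using sets.Int[of _ Q] by (simp add: st)
    qed
    have ss: "sigma_sets (paths S) ?G \<subseteq> path_field S {0..}"
      using sets.sigma_sets_subset[of ?G Q] GQ by (simp add: st sp)
    let ?R = "sigma (paths S) ?G"
    have sR: "sets ?R = sigma_sets (paths S) ?G" "space ?R = paths S"
      using GP by (auto simp: sets_measure_of_conv space_measure_of_conv)
    have sub: "subalgebra Q ?R" "subalgebra Q' ?R" using ss by (auto simp: subalgebra_def sR sp st)
    have "restr_to_subalg Q ?R = restr_to_subalg Q' ?R"
    proof (rule measure_eqI_generator_eq[OF Int GP, where A="\<lambda>_. paths S"])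
      fix X assume "X \<in> ?G"
      moreover from this have "X \<in> sets ?R" by (simp add: sR)
      ultimately show "emeasure (restr_to_subalg Q ?R) X = emeasure (restr_to_subalg Q' ?R) X"
        using eqG sub by (simp add: emeasure_restr_to_subalg)
    next
      have "paths S = paths S \<inter> {\<omega> \<in> paths S. \<omega> (int n + 1) \<in> space S}" by (auto simp: paths_def)
      then show "range (\<lambda>_::nat. paths S) \<subseteq> ?G" using top by blast
      show "emeasure (restr_to_subalg Q ?R) (paths S) \<noteq> \<infinity>"
        using sets.top[of ?R] by (simp add: emeasure_restr_to_subalg[OF sub(1)] sR)
    qed (auto simp: sets_restr_to_subalg sub sR)
    moreover have "B \<in> sets ?R" using Suc.prems gen by (auto simp: sR)
    ultimately show ?case
      using emeasure_restr_to_subalg[OF sub(1), of B] emeasure_restr_to_subalg[OF sub(2), of B] by simp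
  qed
  let ?G = "\<Union>n::nat. path_field S {0..int n}"
  show ?thesis
  proof (rule measure_eqI_generator_eq[where \<Omega>="paths S" and E="?G" and A="\<lambda>_. paths S"])
    show "Int_stable ?G"
    proof (rule Int_stableI, safe)
      fix B B' and n n' :: nat assume "B \<in> path_field S {0..int n}" "B' \<in> path_field S {0..int n'}"
      then have "B \<in> path_field S {0..int (max n n')}" "B' \<in> path_field S {0..int (max n n')}"
        using path_field_mono[of "{0..int n}" "{0..int (max n n')}" S]
          path_field_mono[of "{0..int n'}" "{0..int (max n n')}" S] by auto
      then show "B \<inter> B' \<in> ?G" using sets.Int[of B "?F (max n n')" B'] by auto
    qed
    show GP: "?G \<subseteq> Pow (paths S)" by (auto dest: path_field_into_sp)
    have "path_field S {0..} = sigma_sets (paths S) ?G"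
    proof
      show "path_field S {0..} \<subseteq> sigma_sets (paths S) ?G"
        unfolding path_field_def[of S "{0..}"] coord_field_def
      proof (rule sigma_sets_mono, safe)
        fix k :: int and A assume "0 \<le> k" "A \<in> sets S"
        then have "{\<omega> \<in> paths S. \<omega> k \<in> A} \<in> path_field S {0..int (nat k)}"
          by (intro coord_in_path_field) auto
        then show "{\<omega> \<in> paths S. \<omega> k \<in> A} \<in> sigma_sets (paths S) ?G" by (intro sigma_sets.Basic) blast
      qed
      have "?G \<subseteq> sets Q" unfolding st using path_field_mono[of "{0..int _}" "{0..}" S] by fastforce
      then show "sigma_sets (paths S) ?G \<subseteq> path_field S {0..}"
        using sets.sigma_sets_subset[of ?G Q] by (simp add: st sp)
    qed
    then show "sets Q = sigma_sets (paths S) ?G" "sets Q' = sigma_sets (paths S) ?G" using st by auto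
    show "range (\<lambda>_::nat. paths S) \<subseteq> ?G" using sets.top[of "?F 0"] unfolding sets_path_sigma space_path_sigma by blast
  qed (auto simp: agree)
qed

lemma markov_law_exists: "\<exists>Q. is_markov_law S K \<mu> Q"
proof -
  let ?P = "\<lambda>n (x::nat \<Rightarrow> 's). if n = 0 then \<mu> else K (x (n - 1))"
  interpret IT: Ionescu_Tulcea ?P "\<lambda>_. S"
  proof (rule Ionescu_Tulcea.intro)
    fix i :: nat
    show "?P i \<in> Pi\<^sub>M {0..<i} (\<lambda>_. S) \<rightarrow>\<^sub>M subprob_algebra S"
    proof (cases i)
      case 0 then show ?thesis
        using mu_props by (auto simp: space_subprob_algebra prob_space_imp_subprob_space)
    next
      case (Suc j) then show ?thesis
        using measurable_compose[OF measurable_component_singleton[of j "{0..<i}" "\<lambda>_. S"] K_sub] by simp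
    qed
  next
    fix i :: nat and x :: "nat \<Rightarrow> 's" assume "x \<in> space (Pi\<^sub>M {0..<i} (\<lambda>_. S))"
    then show "prob_space (?P i x)"
      using mu_props K_prob by (cases i) (auto simp: space_PiM PiE_iff)
  qed
  let ?L = "IT.PF.lim"
  let ?g = "\<lambda>(x::nat \<Rightarrow> 's) k. x (nat k)"
  define Q where "Q = distr ?L (sigma (paths S) (path_field S {0..})) ?g"
  have sL: "sets ?L = sets (Pi\<^sub>M UNIV (\<lambda>_. S))" by (rule IT.PF.sets_lim)
  have spL: "x \<in> space (Pi\<^sub>M UNIV (\<lambda>_. S)) \<longleftrightarrow> (\<forall>k. x k \<in> space S)" for x :: "nat \<Rightarrow> 's"
    by (simp add: space_PiM PiE_iff)
  have cL: "(\<lambda>x. x k) \<in> ?L \<rightarrow>\<^sub>M S" for k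
    by (simp add: measurable_cong_sets[OF sL refl])
  have gm: "?g \<in> ?L \<rightarrow>\<^sub>M sigma (paths S) (path_field S {0..})"
    by (rule measurable_into_path_sigma) (auto simp: spL paths_def intro: cL)
  have spQ: "space Q = paths S" and stQ: "sets Q = path_field S {0..}" by (simp_all add: Q_def)
  have upn: "IT.up_to {0..<n} = n" for n
    using IT.up_to_iff[of "{0..<n}"] by (intro order_antisym) (auto, metis IT.up_to atLeastLessThan_iff finite_atLeastLessThan less_irrefl linorder_not_le subsetD zero_le)
  let ?C = "\<lambda>n. IT.C 0 n (\<lambda>_. undefined)"
  have rm: "(\<lambda>x. restrict x {0..<n}) \<in> ?L \<rightarrow>\<^sub>M Pi\<^sub>M {0..<n} (\<lambda>_. S)" for n
    by (auto intro!: measurable_restrict cL)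
  have u: "(\<lambda>_. undefined) \<in> space (Pi\<^sub>M {0..<0::nat} (\<lambda>_. S))" by (simp add: space_PiM)
  have sC: "sets (?C n) = sets (Pi\<^sub>M {0..<n} (\<lambda>_. S))" for n
    using IT.sets_C[OF u, of n] by simp
  have spC: "space (?C n) = space (Pi\<^sub>M {0..<n} (\<lambda>_. S))" for n
    using IT.space_C[OF u, of n] by simp
  have dL: "distr ?L (Pi\<^sub>M {0..<n} (\<lambda>_. S)) (\<lambda>x. restrict x {0..<n}) = ?C n" for n
  proof -
    have "distr ?L (Pi\<^sub>M {0..<n} (\<lambda>_. S)) (\<lambda>x. restrict x {0..<n}) =
        distr (?C n) (Pi\<^sub>M {0..<n} (\<lambda>_. S)) (\<lambda>x. restrict x {0..<n})"
      using IT.distr_lim[of "{0..<n}"] by (simp add: IT.CI_def upn)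
    also have "\<dots> = distr (?C n) (Pi\<^sub>M {0..<n} (\<lambda>_. S)) (\<lambda>x. x)"
      by (rule distr_cong) (auto simp: spC space_PiM PiE_restrict)
    also have "\<dots> = ?C n" by (rule distr_id2) (simp add: sC)
    finally show ?thesis .
  qed
  have "prob_space (?C 0)" by (rule IT.prob_space_C[OF u])
  then interpret L: prob_space ?L
    unfolding dL[symmetric] by (rule prob_space_distrD[OF rm])
  have pQ: "prob_space Q" unfolding Q_def by (rule L.prob_space_distr[OF gm])
  have emL: "emeasure ?L {x \<in> space ?L. restrict x {0..<n} \<in> D} = emeasure (?C n) D"
    if "D \<in> sets (Pi\<^sub>M {0..<n} (\<lambda>_. S))" for n D
    using that by (subst dL[symmetric], subst emeasure_distr[OF rm])
      (auto intro!: arg_cong[where f="emeasure ?L"])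
  have init: "distr Q S (\<lambda>\<omega>. \<omega> 0) = \<mu>"
  proof (rule measure_eqI)
    fix A assume "A \<in> sets (distr Q S (\<lambda>\<omega>. \<omega> 0))"
    then have A: "A \<in> sets S" by simp
    let ?D = "{x \<in> space (Pi\<^sub>M {0..<Suc 0} (\<lambda>_. S)). x 0 \<in> A}"
    have D: "?D \<in> sets (Pi\<^sub>M {0..<Suc 0} (\<lambda>_. S))"
      using A by measurable
    have "emeasure (distr Q S (\<lambda>\<omega>. \<omega> 0)) A = emeasure ?L {x \<in> space ?L. x 0 \<in> A}"
      unfolding Q_def using A
      by (subst distr_distr[OF measurable_coord gm])
        (auto simp: emeasure_distr cL comp_def intro!: arg_cong[where f="emeasure ?L"])
    also have "{x \<in> space ?L. x 0 \<in> A} = {x \<in> space ?L. restrict x {0..<Suc 0} \<in> ?D}"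
      by (auto simp: spL space_PiM)
    also have "emeasure ?L \<dots> = emeasure (?C (Suc 0)) ?D" by (rule emL[OF D])
    also have "?C (Suc 0) = IT.eP 0 (\<lambda>_. undefined)"
      using bind_return[OF IT.measurable_eP u] by simp
    also have "emeasure \<dots> ?D = emeasure \<mu> ((\<lambda>x. (\<lambda>_. undefined)(0 := x)) -` ?D \<inter> space S)"
      using IT.emeasure_eP[OF u D] by simp
    also have "(\<lambda>x. (\<lambda>_. undefined)(0 := x)) -` ?D \<inter> space S = A"
      using sets.sets_into_space[OF A] by (auto simp: space_PiM PiE_iff extensional_def)
    finally show "emeasure (distr Q S (\<lambda>\<omega>. \<omega> 0)) A = emeasure \<mu> A" .
  qed (simp add: mu_props)
  have markov: "measure Q (B \<inter> {\<omega> \<in> paths S. \<omega> (int n + 1) \<in> A})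
        = (\<integral>\<omega>. indicator B \<omega> * measure (K (\<omega> (int n))) A \<partial>Q)"
    if A: "A \<in> sets S" and B: "B \<in> path_field S {0..int n}" for n A B
  proof -
    interpret Q: prob_space Q by (rule pQ)
    let ?h = "\<lambda>x k. x (min (nat k) n) :: 's"
    let ?N = "Pi\<^sub>M {0..<Suc n} (\<lambda>_. S)" and ?N' = "Pi\<^sub>M {0..<Suc (Suc n)} (\<lambda>_. S)"
    define D where "D = {x \<in> space ?N. ?h x \<in> B}"
    have hm: "?h \<in> ?N \<rightarrow>\<^sub>M sigma (paths S) (path_field S {0..int n})"
      by (rule measurable_into_path_sigma)
        (auto simp: paths_def space_PiM intro!: measurable_component_singleton)
    have D: "D \<in> sets ?N"
      using measurable_sets[OF hm, of B] B by (simp add: D_def vimage_def Int_def conj_commute)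
    have gB: "?g x \<in> B \<longleftrightarrow> restrict x {0..<Suc n} \<in> D" if "x \<in> space ?L" for x
    proof -
      have "?g x \<in> B \<longleftrightarrow> ?h (restrict x {0..<Suc n}) \<in> B"
        by (rule path_field_determined[OF B]) (use that in \<open>auto simp: paths_def spL\<close>)
      then show ?thesis using that by (auto simp: D_def space_PiM spL)
    qed
    define D' where "D' = {x \<in> space ?N'. restrict x {0..<Suc n} \<in> D \<and> x (Suc n) \<in> A}"
    have rN: "(\<lambda>x. restrict x {0..<Suc n}) \<in> ?N' \<rightarrow>\<^sub>M ?N"
      by (rule measurable_restrict_subset) auto
    have D': "D' \<in> sets ?N'"
    proof -
      have "D' = ((\<lambda>x. restrict x {0..<Suc n}) -` D \<inter> space ?N') \<inter> ((\<lambda>x. x (Suc n)) -` A \<inter> space ?N')"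
        by (auto simp: D'_def)
      then show ?thesis
        using measurable_sets[OF rN D] measurable_sets[OF measurable_component_singleton[of "Suc n" "{0..<Suc (Suc n)}" "\<lambda>_. S"] A]
        by auto
    qed
    have Cm: "{\<omega> \<in> paths S. \<omega> (int n + 1) \<in> A} \<in> sets Q"
      using A unfolding stQ by (intro coord_in_path_field) auto
    have BQ: "B \<in> sets Q" using B path_field_mono[of "{0..int n}" "{0..}" S] by (auto simp: stQ)
    have km: "(\<lambda>y. emeasure (K y) A) \<in> borel_measurable S"
      using measurable_emeasure_kernel[OF K_sub A] .
    have kQ: "(\<lambda>\<omega>. emeasure (K (\<omega> (int n))) A) \<in> borel_measurable (sigma (paths S) (path_field S {0..}))"
      using measurable_compose[OF measurable_coord[of "int n" "{0..}" S] km] by simp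
    have kN: "(\<lambda>x. emeasure (K (x n)) A) \<in> borel_measurable ?N"
      using measurable_compose[OF measurable_component_singleton[of n "{0..<Suc n}" "\<lambda>_. S"] km] by simp
    have "emeasure Q (B \<inter> {\<omega> \<in> paths S. \<omega> (int n + 1) \<in> A}) =
        emeasure ?L {x \<in> space ?L. restrict x {0..<Suc (Suc n)} \<in> D'}"
      unfolding Q_def
    proof (subst emeasure_distr[OF gm])
      show "B \<inter> {\<omega> \<in> paths S. \<omega> (int n + 1) \<in> A} \<in> sets (sigma (paths S) (path_field S {0..}))"
        using sets.Int[OF BQ Cm] by (simp add: stQ)
      have r: "restrict (restrict x {0..<Suc (Suc n)}) {0..<Suc n} = restrict x {0..<Suc n}" for x :: "nat \<Rightarrow> 's"
        by auto
      show "emeasure ?L (?g -` (B \<inter> {\<omega> \<in> paths S. \<omega> (int n + 1) \<in> A}) \<inter> space ?L) =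
        emeasure ?L {x \<in> space ?L. restrict x {0..<Suc (Suc n)} \<in> D'}"
        using gB by (intro arg_cong[where f="emeasure ?L"])
          (auto simp: D'_def r nat_add_distrib, auto simp: spL space_PiM paths_def)
    qed
    also have "\<dots> = emeasure (?C (Suc (Suc n))) D'" by (rule emL[OF D'])
    also have "?C (Suc (Suc n)) = ?C (Suc n) \<bind> IT.eP (Suc n)" by simp
    also have "emeasure \<dots> D' = (\<integral>\<^sup>+x. emeasure (IT.eP (Suc n) x) D' \<partial>?C (Suc n))"
    proof (rule emeasure_bind[OF _ _ D'])
      show "space (?C (Suc n)) \<noteq> {}" unfolding spC using IT.non_empty by (auto simp: space_PiM PiE_eq_empty_iff)
      show "IT.eP (Suc n) \<in> ?C (Suc n) \<rightarrow>\<^sub>M subprob_algebra ?N'"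
        unfolding measurable_cong_sets[OF sC refl] by (rule IT.measurable_eP)
    qed
    also have "\<dots> = (\<integral>\<^sup>+x. indicator D x * emeasure (K (x n)) A \<partial>?C (Suc n))"
    proof (rule nn_integral_cong)
      fix x assume "x \<in> space (?C (Suc n))"
      then have x: "x \<in> space ?N" using spC by metis
      have "emeasure (IT.eP (Suc n) x) D' = emeasure (K (x n)) ((\<lambda>y. x(Suc n := y)) -` D' \<inter> space S)"
        using IT.emeasure_eP[OF x D'] by simp
      also have "(\<lambda>y. x(Suc n := y)) -` D' \<inter> space S = (if x \<in> D then A else {})"
      proof -
        have "restrict (x(Suc n := y)) {0..<Suc n} = x" for y
          using x by (auto simp: space_PiM PiE_iff extensional_def restrict_def fun_eq_iff)
        moreover have "x(Suc n := y) \<in> space ?N'" if "y \<in> space S" for y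
          using x that by (auto simp: space_PiM PiE_iff extensional_def)
        ultimately show ?thesis using sets.sets_into_space[OF A] by (auto simp: D'_def)
      qed
      finally show "emeasure (IT.eP (Suc n) x) D' = indicator D x * emeasure (K (x n)) A" by simp
    qed
    also have "\<dots> = (\<integral>\<^sup>+x. indicator D x * emeasure (K (x n)) A \<partial>distr ?L ?N (\<lambda>x. restrict x {0..<Suc n}))"
      by (simp only: dL)
    also have "\<dots> = (\<integral>\<^sup>+x. indicator D (restrict x {0..<Suc n}) * emeasure (K (restrict x {0..<Suc n} n)) A \<partial>?L)"
      using D kN by (intro nn_integral_distr[OF rm]) (intro borel_measurable_times_ennreal borel_measurable_indicator; simp)
    also have "\<dots> = (\<integral>\<^sup>+x. indicator B (?g x) * emeasure (K (?g x (int n))) A \<partial>?L)"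
      using gB by (intro nn_integral_cong) (auto split: split_indicator)
    also have "\<dots> = (\<integral>\<^sup>+\<omega>. indicator B \<omega> * emeasure (K (\<omega> (int n))) A \<partial>Q)"
      unfolding Q_def using BQ kQ
      by (intro nn_integral_distr[OF gm, symmetric]) (intro borel_measurable_times_ennreal borel_measurable_indicator; simp add: stQ)
    also have "\<dots> = (\<integral>\<^sup>+\<omega>. ennreal (indicator B \<omega> * measure (K (\<omega> (int n))) A) \<partial>Q)"
    proof (rule nn_integral_cong)
      fix \<omega> assume "\<omega> \<in> space Q"
      then have "\<omega> (int n) \<in> space S" by (auto simp: spQ paths_def)
      then interpret k: prob_space "K (\<omega> (int n))" by (rule K_prob)
      show "indicator B \<omega> * emeasure (K (\<omega> (int n))) A = ennreal (indicator B \<omega> * measure (K (\<omega> (int n))) A)"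
        by (auto simp: k.emeasure_eq_measure split: split_indicator)
    qed
    finally have e: "emeasure Q (B \<inter> {\<omega> \<in> paths S. \<omega> (int n + 1) \<in> A}) =
      (\<integral>\<^sup>+\<omega>. ennreal (indicator B \<omega> * measure (K (\<omega> (int n))) A) \<partial>Q)" .
    have "(\<integral>\<omega>. indicator B \<omega> * measure (K (\<omega> (int n))) A \<partial>Q) =
      enn2real (\<integral>\<^sup>+\<omega>. ennreal (indicator B \<omega> * measure (K (\<omega> (int n))) A) \<partial>Q)"
    proof (rule integral_eq_nn_integral)
      have "(\<lambda>\<omega>. measure (K (\<omega> (int n))) A) \<in> borel_measurable Q"
        using measurable_K_coord[OF A, of "int n" "{0..}"] by (simp add: Q_def)
      then show "(\<lambda>\<omega>. indicator B \<omega> * measure (K (\<omega> (int n))) A) \<in> borel_measurable Q"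
        using BQ by measurable
    qed auto
    then show ?thesis by (simp only: e Sigma_Algebra.measure_def[of Q])
  qed
  show ?thesis unfolding is_markov_law_iff using pQ spQ stQ init markov by blast
qed

end

lemma is_markov_law_chain_law:
  assumes "K \<in> S \<rightarrow>\<^sub>M prob_algebra S" "\<mu> \<in> space (prob_algebra S)"
  shows "is_markov_law S K \<mu> Q \<longleftrightarrow> Q = chain_law S K \<mu>"
proof -
  interpret markov_law_setup S K \<mu> by standard (use assms in auto)
  have "\<exists>!Q. is_markov_law S K \<mu> Q"
    using markov_law_exists markov_law_unique by blast
  then show ?thesis unfolding chain_law_def by (metis theI')
qed

end

theory Submission
  imports Defs
begin

text \<open>
  The three conditions are proved to be equivalent by a cycle: local mixing yields the uniform
  overlap of the laws started at points, the overlap yields triviality of the local tails, and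
  triviality yields mixing. Everything happens for one observable \<open>f\<close> of the chain at a time,
  here the restriction of a state to the finite set \<open>J\<close> of coordinates; the process
  \<open>f (X\<^sub>k)\<close> is in general not Markov, but \<open>X\<^sub>k\<close> is. Mixing implies overlap
  because the distances in question tend to zero, so that they are eventually at most 1.

  \<^emph>\<open>Overlap implies triviality.\<close> Let \<open>A\<close> be a tail event of \<open>f (X\<^sub>k)\<close> and let
  \<open>B\<close> depend on the chain up to time \<open>n\<close> only. By the Markov property the conditional
  probability of \<open>A\<close> given \<open>B\<close> is the probability, for the chain with some other initial law, of
  the event \<open>A\<close> shifted by \<open>n\<close>, which is again a tail event
  (\<open>conditional_prob_tail_event\<close>). Two such probabilities differ by at most
  \<open>c = 1 - \<alpha> / 2\<close>: for initial laws concentrated at points this is the hypothesis, and averaging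
  carries it over to all initial laws (\<open>tail_prob_diff_le\<close>). So the conditional probabilities of
  \<open>A\<close> given \<open>B\<close> and given the complement of \<open>B\<close> differ by at most \<open>c < 1\<close>, uniformly in \<open>B\<close> and
  \<open>n\<close>. Since \<open>B\<close> may approximate \<open>A\<close> itself, for which these conditional probabilities would be 1
  and 0, the event \<open>A\<close> must have probability 0 or 1 (\<open>trivial_if_contracting\<close>). The events of
  probability 0 or 1 form a \<open>\<sigma>\<close>-algebra, so triviality passes to the join over all finite \<open>J\<close>.

  \<^emph>\<open>Triviality implies mixing.\<close> Along a decreasing sequence of \<open>\<sigma>\<close>-algebras the total variation
  distance of two probability measures converges to twice the difference of their values on one
  event of the intersection (\<open>tv_dist_tail_attained\<close>). Hence the distances in the definition of
  mixing converge to twice the difference of the two path measures on a tail event \<open>A\<close>. Both of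
  them give \<open>A\<close> probability 0 or 1, and so does the chain started from the half-half mixture of the
  initial laws, whose probability of \<open>A\<close> is the mean of the two; therefore they agree on \<open>A\<close>.

  Both arguments need that the law of the chain depends measurably on the starting point and that
  the law with initial distribution \<open>\<mu>\<close> is the \<open>\<mu>\<close>-average of these (\<open>chain_law_eq_bind\<close>). This and
  the Markov property are obtained by exhibiting a measure that satisfies the characterization of
  the law of the chain, and appealing to uniqueness.
\<close>

section \<open>Total variation distance along decreasing \<sigma>-algebras\<close>

lemma (in prob_space) abs_prob_diff_le_1:
  assumes "prob_space N"
  shows "\<bar>prob A - measure N A\<bar> \<le> 1"
  using prob_le_1[of A] prob_space.prob_le_1[OF assms, of A] measure_nonneg[of M A] measure_nonneg[of N A]
  by linarith

lemma bdd_above_abs_prob_diff: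
  assumes "prob_space M" "prob_space N"
  shows "bdd_above ((\<lambda>A. \<bar>measure M A - measure N A\<bar>) ` G)"
  using prob_space.abs_prob_diff_le_1[OF assms] by (intro bdd_aboveI2)

lemma abs_prob_diff_le_tv_dist:
  assumes "prob_space M" "prob_space N" "A \<in> G"
  shows "2 * \<bar>measure M A - measure N A\<bar> \<le> tv_dist G M N"
  unfolding tv_dist_def using cSUP_upper[OF assms(3) bdd_above_abs_prob_diff[OF assms(1,2)]] by simp

lemma tv_dist_mono:
  assumes "prob_space M" "prob_space N" "G \<noteq> {}" "G \<subseteq> H"
  shows "tv_dist G M N \<le> tv_dist H M N"
  unfolding tv_dist_def
  by (intro mult_left_mono cSUP_subset_mono bdd_above_abs_prob_diff assms) auto

text \<open>
  The absolute value in the total variation distance can be dropped because complementing an event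
  changes the sign of the difference of the two probabilities.
\<close>

lemma tv_dist_near_maximal:
  assumes M: "prob_space M" "space M = \<Omega>" and N: "prob_space N" "space N = \<Omega>"
    and G: "sigma_algebra \<Omega> G" "G \<subseteq> sets M" "G \<subseteq> sets N" and e: "e > 0"
  shows "\<exists>A\<in>G. tv_dist G M N / 2 - e \<le> measure M A - measure N A"
proof -
  interpret M: prob_space M by fact
  interpret N: prob_space N by fact
  interpret G: sigma_algebra \<Omega> G by fact
  let ?D = "\<lambda>A. measure M A - measure N A"
  have "G \<noteq> {}" using G.top by auto
  moreover have "tv_dist G M N / 2 - e < (SUP A\<in>G. \<bar>?D A\<bar>)" using e by (simp add: tv_dist_def)
  ultimately obtain A where A: "A \<in> G" "tv_dist G M N / 2 - e < \<bar>?D A\<bar>"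
    using less_cSUP_iff[OF _ bdd_above_abs_prob_diff[OF M(1) N(1), of G]] by blast
  have "?D (\<Omega> - A) = - ?D A"
    using subsetD[OF G(2) A(1)] subsetD[OF G(3) A(1)] M(2) N(2) M.prob_compl[of A] N.prob_compl[of A]
    by simp
  moreover have "\<Omega> - A \<in> G" using A(1) by auto
  ultimately show ?thesis
    using A by (cases "?D A \<ge> 0") (auto intro: bexI[of _ A] bexI[of _ "\<Omega> - A"])
qed

text \<open>
  The construction is that of the Hahn decomposition. Write \<open>D\<close> for the difference of the two
  measures and \<open>d n\<close> for the supremum of \<open>D\<close> over \<open>F n\<close>, which decreases to a limit \<open>L\<close>. Choose
  \<open>A n \<in> F n\<close> with \<open>D (A n)\<close> within \<open>2\<^sup>-\<^sup>n\<close> of \<open>d n\<close>. If \<open>U \<in> F m\<close>, then also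
  \<open>A m \<inter> U \<in> F m\<close>, so
  \<open>D (A m \<union> U) = D (A m) + D U - D (A m \<inter> U) \<ge> D U - 2\<^sup>-\<^sup>m\<close>: adding \<open>A m\<close> to \<open>U\<close> costs at most
  \<open>2\<^sup>-\<^sup>m\<close>. The upper limit of the sets \<open>A n\<close> lies in the intersection, and by these estimates
  \<open>D\<close> is at least \<open>L\<close> on it.
\<close>

lemma tv_dist_tail_attained:
  fixes F :: "nat \<Rightarrow> 'w set set"
  assumes M: "prob_space M" "space M = \<Omega>" and N: "prob_space N" "space N = \<Omega>"
    and F: "\<And>n. sigma_algebra \<Omega> (F n)" "decseq F" "\<And>n. F n \<subseteq> sets M" "\<And>n. F n \<subseteq> sets N"
  shows "\<exists>A\<in>\<Inter>n. F n. (\<lambda>n. tv_dist (F n) M N) \<longlonglongrightarrow> 2 * (measure M A - measure N A)"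
proof -
  interpret M: prob_space M by fact
  interpret N: prob_space N by fact
  let ?D = "\<lambda>A. measure M A - measure N A"
  define d where "d n = tv_dist (F n) M N / 2" for n
  have top: "\<Omega> \<in> F n" for n using sigma_algebra.axioms(1)[OF F(1)] algebra.top by auto
  have D_le: "?D A \<le> d n" if "A \<in> F n" for A n
  proof -
    have "2 * ?D A \<le> 2 * \<bar>?D A\<bar>" by (intro mult_left_mono abs_ge_self) simp
    also have "\<dots> \<le> tv_dist (F n) M N" by (rule abs_prob_diff_le_tv_dist[OF M(1) N(1) that])
    finally show ?thesis by (simp add: d_def)
  qed
  have "decseq d"
    unfolding decseq_def d_def using F(2) top
    by (auto intro!: divide_right_mono tv_dist_mono[OF M(1) N(1)] dest: decseqD)
  moreover have "0 \<le> d n" for n using D_le[OF top, of n] M.prob_space N.prob_space M(2) N(2) by simp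
  ultimately obtain L where L: "d \<longlonglongrightarrow> L" "\<And>n. L \<le> d n"
    using decseq_convergent[of d 0] by blast
  have "\<forall>n. \<exists>A\<in>F n. d n - (1/2)^n \<le> ?D A"
    unfolding d_def using M N F by (intro allI tv_dist_near_maximal) auto
  then obtain A where A: "\<And>n. A n \<in> F n" "\<And>n. d n - (1/2)^n \<le> ?D (A n)" by metis
  have AF: "A k \<in> F m" if "m \<le> k" for k m using A(1)[of k] decseqD[OF F(2) that] by blast
  have UF: "(\<Union>k\<in>K. A k) \<in> F m" if "K \<subseteq> {m..}" for K m
  proof -
    interpret sigma_algebra \<Omega> "F m" by (rule F)
    show ?thesis using that AF by (intro countable_UN') auto
  qed
  note Fsets = subsetD[OF F(3)] subsetD[OF F(4)]
  (* The summand (1/2)^(m+j) makes the bound exact for the geometric sum of the costs. *)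
  have fin: "L - 2 * (1/2)^m + (1/2)^(m+j) \<le> ?D (\<Union>k\<in>{m..m+j}. A k)" for m j
  proof (induction j arbitrary: m)
    case 0
    then show ?case using A(2)[of m] L(2)[of m] by simp
  next
    case (Suc j)
    let ?U = "\<Union>k\<in>{Suc m..Suc m+j}. A k"
    have U: "?U \<in> F m" by (rule UF) auto
    interpret Fm: sigma_algebra \<Omega> "F m" by (rule F)
    have mem: "A m \<inter> ?U \<in> F m" by (rule Fm.Int[OF A(1) U])
    have "{m..m + Suc j} = insert m {Suc m..Suc m+j}" by auto
    then have "(\<Union>k\<in>{m..m + Suc j}. A k) = A m \<union> ?U" by simp
    moreover have "?D (A m \<union> ?U) = ?D (A m) + ?D ?U - ?D (A m \<inter> ?U)"
      using measure_Un3[of "A m" M ?U] measure_Un3[of "A m" N ?U] U A(1)[of m] Fsets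
      by (simp add: M.fmeasurable_eq_sets N.fmeasurable_eq_sets)
    ultimately show ?case using D_le[OF mem] A(2)[of m] Suc.IH[of "Suc m"] by simp
  qed
  define U where "U m = (\<Union>k\<in>{m..}. A k)" for m
  have Um: "L - 2 * (1/2)^m \<le> ?D (U m)" for m
  proof -
    let ?V = "\<lambda>j. \<Union>k\<in>{m..m+j}. A k"
    have VF: "?V j \<in> F m" for j by (rule UF) auto
    have inc: "incseq ?V" by (intro incseq_SucI UN_mono) auto
    have "U m = (\<Union>j. ?V j)"
      unfolding U_def by (auto, metis atLeastAtMost_iff le_add_diff_inverse order_refl)
    then have "(\<lambda>j. ?D (?V j)) \<longlonglongrightarrow> ?D (U m)"
      using VF[THEN Fsets(1)] VF[THEN Fsets(2)]
      by (auto intro!: tendsto_diff M.finite_Lim_measure_incseq[OF _ inc] N.finite_Lim_measure_incseq[OF _ inc])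
    moreover have "(\<lambda>j. L - 2 * (1/2)^m + (1/2)^m * (1/2)^j) \<longlonglongrightarrow> L - 2 * (1/2)^m + (1/2)^m * 0"
      by (intro tendsto_intros LIMSEQ_power_zero) auto
    ultimately show ?thesis using fin[of m] by (intro LIMSEQ_le[of _ "L - 2 * (1/2)^m"]) (auto simp: power_add)
  qed
  have dec: "decseq U" unfolding U_def decseq_def by fastforce
  have UmF: "U m \<in> F m" for m unfolding U_def by (rule UF) auto
  have "(\<lambda>m. ?D (U m)) \<longlonglongrightarrow> ?D (\<Inter>m. U m)"
    using UmF[THEN Fsets(1)] UmF[THEN Fsets(2)]
    by (auto intro!: tendsto_diff M.finite_Lim_measure_decseq[OF _ dec] N.finite_Lim_measure_decseq[OF _ dec])
  moreover have "(\<lambda>m. L - 2 * (1/2)^m) \<longlonglongrightarrow> L - 2 * 0"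
    by (intro tendsto_intros LIMSEQ_power_zero) auto
  ultimately have ge: "L \<le> ?D (\<Inter>m. U m)" using Um LIMSEQ_le[of _ "L - 2 * 0"] by auto
  have tail: "(\<Inter>m. U m) \<in> F n" for n
  proof -
    interpret sigma_algebra \<Omega> "F n" by (rule F)
    have "(\<Inter>m. U m) = (\<Inter>m\<in>{n..}. U m)"
    proof (rule antisym)
      show "(\<Inter>m\<in>{n..}. U m) \<subseteq> (\<Inter>m. U m)"
      proof (rule INT_greatest)
        fix m
        have "(\<Inter>m\<in>{n..}. U m) \<subseteq> U (max n m)" by (rule INT_lower) simp
        also have "\<dots> \<subseteq> U m" by (rule decseqD[OF dec]) simp
        finally show "(\<Inter>m\<in>{n..}. U m) \<subseteq> U m" .
      qed
    qed auto
    moreover have "U m \<in> F n" if "n \<le> m" for m using UmF[of m] decseqD[OF F(2) that] by blast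
    ultimately show ?thesis by (auto intro!: countable_INT')
  qed
  have "?D (\<Inter>m. U m) \<le> L" using D_le[OF tail] by (intro LIMSEQ_le_const[OF L(1)]) auto
  with ge have "L = ?D (\<Inter>m. U m)" by simp
  with tendsto_mult_left[OF L(1), of 2] have "(\<lambda>n. tv_dist (F n) M N) \<longlonglongrightarrow> 2 * ?D (\<Inter>m. U m)"
    by (simp add: d_def)
  with tail show ?thesis by blast
qed

section \<open>Zero-one criteria for probability measures\<close>

lemma (in prob_space) approx_by_generating_algebra:
  assumes G: "algebra (space M) G" "sets M = sigma_sets (space M) G"
    and A: "A \<in> sets M" and e: "e > 0"
  shows "\<exists>B\<in>G. prob (sym_diff A B) < e"
proof -
  interpret G: algebra "space M" G by fact
  have GM: "G \<subseteq> sets M" unfolding G(2) by auto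
  have "A \<in> sigma_sets (space M) G" using A G(2) by simp
  then have "\<forall>e>0. \<exists>B\<in>G. prob (sym_diff A B) < e"
  proof induction
    case (Basic A)
    then show ?case by (intro allI impI bexI[of _ A]) auto
  next
    case Empty
    show ?case by (intro allI impI bexI[of _ "{}"]) auto
  next
    case (Compl A)
    have AM: "A \<in> sets M" using Compl G(2) by simp
    show ?case
    proof (intro allI impI)
      fix e :: real assume "e > 0"
      then obtain B where B: "B \<in> G" "prob (sym_diff A B) < e" using Compl by blast
      have "sym_diff (space M - A) (space M - B) = sym_diff A B"
        using sets.sets_into_space[OF AM] G.sets_into_space[OF B(1)] by blast
      with B show "\<exists>B\<in>G. prob (sym_diff (space M - A) B) < e"
        by (intro bexI[of _ "space M - B"]) auto
    qed
  next
    case (Union a)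
    have aM: "a i \<in> sets M" for i using Union(1)[of i] G(2) by simp
    show ?case
    proof (intro allI impI)
      fix e :: real assume e: "e > 0"
      have "\<forall>i. \<exists>B\<in>G. prob (sym_diff (a i) B) < (e/2) * (1/2)^Suc i"
        using Union.IH e by (metis half_gt_zero mult_pos_pos zero_less_one zero_less_power)
      then obtain B where B: "\<And>i. B i \<in> G" "\<And>i. prob (sym_diff (a i) (B i)) < (e/2) * (1/2)^Suc i"
        by metis
      have BM: "B i \<in> sets M" for i using B(1) GM by auto
      have dec: "decseq (\<lambda>n. (\<Union>i. a i) - (\<Union>i<n. a i))"
        by (rule decseq_SucI) (auto simp: less_Suc_eq)
      have em: "(\<Inter>n. (\<Union>i. a i) - (\<Union>i<n. a i)) = {}" by auto
      have "(\<lambda>n. prob ((\<Union>i. a i) - (\<Union>i<n. a i))) \<longlonglongrightarrow> 0"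
        using finite_Lim_measure_decseq[OF _ dec] aM unfolding em by auto
      then have "\<forall>\<^sub>F n in sequentially. prob ((\<Union>i. a i) - (\<Union>i<n. a i)) < e/2"
        using e by (intro order_tendstoD) auto
      then obtain n where n: "prob ((\<Union>i. a i) - (\<Union>i<n. a i)) < e/2"
        by (meson eventually_sequentially order_refl)
      have "prob (sym_diff (\<Union>i. a i) (\<Union>i<n. B i)) \<le>
          prob (((\<Union>i. a i) - (\<Union>i<n. a i)) \<union> (\<Union>i<n. sym_diff (a i) (B i)))"
        using aM BM by (intro finite_measure_mono) auto
      also have "\<dots> \<le> prob ((\<Union>i. a i) - (\<Union>i<n. a i)) + prob (\<Union>i<n. sym_diff (a i) (B i))"
        using aM BM by (intro measure_Un_le) auto
      also have "prob (\<Union>i<n. sym_diff (a i) (B i)) \<le> (\<Sum>i<n. prob (sym_diff (a i) (B i)))"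
        using aM BM by (intro finite_measure_subadditive_finite) auto
      also have "\<dots> \<le> (\<Sum>i<n. (e/2) * (1/2)^Suc i)" using B(2) by (intro sum_mono less_imp_le)
      also have "\<dots> \<le> e/2"
      proof -
        have "(\<Sum>i<n. (e/2) * (1/2)^Suc i) = (e/2) * (1 - (1/2)^n)"
          by (induction n) (auto simp: algebra_simps)
        then show ?thesis using e by (simp add: mult_left_le)
      qed
      finally have "prob (sym_diff (\<Union>i. a i) (\<Union>i<n. B i)) < e" using n by simp
      moreover have "(\<Union>i<n. B i) \<in> G" using B(1) by (intro G.finite_UN) auto
      ultimately show "\<exists>B\<in>G. prob (sym_diff (\<Union>i. a i) B) < e" by blast
    qed
  qed
  with e show ?thesis by blast
qed

text \<open>
  After division by the probabilities of \<open>B\<close> and of its complement, the hypothesis bounds the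
  difference of the conditional probabilities of \<open>A\<close> by \<open>c\<close>. In this product form it also covers
  null sets and is continuous in \<open>B\<close>, so it may be applied to \<open>B = A\<close>, where it reads
  \<open>p (1 - p) \<le> c p (1 - p)\<close> for the probability \<open>p\<close> of \<open>A\<close>.
\<close>

lemma (in prob_space) trivial_if_contracting:
  assumes G: "algebra (space M) G" "sets M = sigma_sets (space M) G"
    and A: "A \<in> sets M" and c: "c < 1"
    and contr: "\<And>B. B \<in> G \<Longrightarrow>
      prob (A \<inter> B) * prob (space M - B) - prob (A \<inter> (space M - B)) * prob B
        \<le> c * (prob B * prob (space M - B))"
  shows "prob A \<in> {0, 1}"
proof -
  have GM: "G \<subseteq> sets M" unfolding G(2) by auto
  have "\<forall>n. \<exists>B\<in>G. prob (sym_diff A B) < (1/2)^n"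
    using approx_by_generating_algebra[OF G A] by simp
  then obtain B where B: "\<And>n. B n \<in> G" "\<And>n. prob (sym_diff A (B n)) < (1/2)^n" by metis
  have BM: "B n \<in> sets M" for n using B(1) GM by auto
  have half: "(\<lambda>n. (1/2)^n) \<longlonglongrightarrow> (0::real)" by (intro LIMSEQ_power_zero) auto
  have lim: "(\<lambda>n. prob (C n)) \<longlonglongrightarrow> prob C'"
    if "\<And>n. C n \<in> sets M" "C' \<in> sets M" "\<And>n. sym_diff C' (C n) \<subseteq> sym_diff A (B n)" for C C'
  proof (rule tendsto_dist_iff[THEN iffD2], rule Lim_null_comparison[OF _ half], rule always_eventually, rule allI)
    fix n
    have "prob (C n) \<le> prob (C' \<union> sym_diff C' (C n))" "prob C' \<le> prob (C n \<union> sym_diff C' (C n))"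
      using that by (auto intro!: finite_measure_mono)
    moreover have "prob (C' \<union> sym_diff C' (C n)) \<le> prob C' + prob (sym_diff C' (C n))"
      "prob (C n \<union> sym_diff C' (C n)) \<le> prob (C n) + prob (sym_diff C' (C n))"
      using that by (auto intro!: measure_Un_le)
    ultimately have "\<bar>prob (C n) - prob C'\<bar> \<le> prob (sym_diff C' (C n))"
      by linarith
    also have "\<dots> \<le> prob (sym_diff A (B n))"
      using that A BM by (intro finite_measure_mono) auto
    finally show "norm (dist (prob (C n)) (prob C')) \<le> (1/2)^n"
      using B(2)[of n] by (simp add: dist_real_def)
  qed
  have l: "(\<lambda>n. prob (A \<inter> B n)) \<longlonglongrightarrow> prob A" "(\<lambda>n. prob (B n)) \<longlonglongrightarrow> prob A"
    "(\<lambda>n. prob (space M - B n)) \<longlonglongrightarrow> prob (space M - A)"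
    "(\<lambda>n. prob (A \<inter> (space M - B n))) \<longlonglongrightarrow> prob {}"
    using A BM sets.sets_into_space[OF A] by (intro lim; auto)+
  have "(\<lambda>n. prob (A \<inter> B n) * prob (space M - B n) - prob (A \<inter> (space M - B n)) * prob (B n))
      \<longlonglongrightarrow> prob A * prob (space M - A) - prob {} * prob A"
    by (intro tendsto_diff tendsto_mult l)
  moreover have "(\<lambda>n. c * (prob (B n) * prob (space M - B n))) \<longlonglongrightarrow> c * (prob A * prob (space M - A))"
    by (intro tendsto_mult tendsto_const l)
  ultimately have "prob A * prob (space M - A) - prob {} * prob A \<le> c * (prob A * prob (space M - A))"
    using contr[OF B(1)] by (intro LIMSEQ_le) auto
  then have "(1 - c) * (prob A * (1 - prob A)) \<le> 0" using A by (simp add: prob_compl algebra_simps)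
  then have "prob A * (1 - prob A) \<le> 0" using c by (simp add: mult_le_0_iff)
  moreover have "0 \<le> prob A * (1 - prob A)" by (simp add: mult_nonneg_nonneg)
  ultimately have "prob A * (1 - prob A) = 0" by linarith
  then show ?thesis by auto
qed

lemma (in prob_space) trivial_sigma_sets:
  assumes G: "G \<subseteq> sets M" "\<And>A. A \<in> G \<Longrightarrow> prob A \<in> {0, 1}"
    and A: "A \<in> sigma_sets (space M) G"
  shows "prob A \<in> {0, 1}"
  using A
proof induction
  case (Compl A)
  then have "A \<in> sets M" using sets.sigma_sets_subset[OF G(1)] by auto
  then show ?case using Compl by (auto simp: prob_compl)
next
  case (Union a)
  have a: "a i \<in> sets M" for i using Union(1) sets.sigma_sets_subset[OF G(1)] by auto
  show ?case
  proof (cases "\<exists>i. prob (a i) = 1")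
    case True
    then obtain i where "prob (a i) = 1" by blast
    moreover have "prob (a i) \<le> prob (\<Union>i. a i)" using a by (intro finite_measure_mono) auto
    ultimately have "prob (\<Union>i. a i) = 1" using prob_le_1[of "\<Union>i. a i"] by linarith
    then show ?thesis by simp
  next
    case False
    then have "emeasure M (a i) = 0" for i using Union.IH[of i] by (auto simp: emeasure_eq_measure)
    then have "emeasure M (\<Union>i. a i) = 0" using a by (intro emeasure_UN_eq_0) auto
    then show ?thesis by (simp add: emeasure_eq_measure)
  qed
qed (use G in auto)

section \<open>\<sigma>-algebras on path space and the shift\<close>

definition shift :: "int \<Rightarrow> (int \<Rightarrow> 's) \<Rightarrow> int \<Rightarrow> 's" where
  "shift c \<omega> = (\<lambda>k. \<omega> (k + c))"

lemma shift_apply: "shift c \<omega> k = \<omega> (k + c)"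
  by (simp add: shift_def)

lemma shift_in_paths_iff [simp]: "shift c \<omega> \<in> paths S \<longleftrightarrow> \<omega> \<in> paths S"
proof
  assume "shift c \<omega> \<in> paths S"
  then have "\<omega> ((k - c) + c) \<in> space S" for k unfolding paths_def shift_def by blast
  then show "\<omega> \<in> paths S" by (simp add: paths_def)
qed (simp add: paths_def shift_apply)

lemma shift_shift [simp]: "shift c (shift d \<omega>) = shift (c + d) \<omega>"
  by (simp add: shift_def add.assoc)

lemma shift_0 [simp]: "shift 0 \<omega> = \<omega>"
  by (simp add: shift_def)

lemma shift_vimage_coord_field:
  assumes "A \<in> coord_field S f N T" "\<And>k. k \<in> T \<Longrightarrow> k + c \<in> U"
  shows "{\<omega> \<in> paths S. shift c \<omega> \<in> A} \<in> coord_field S f N U"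
  using assms(1) unfolding coord_field_def[of S f N T]
proof induction
  case (Basic A)
  then obtain k B where "A = {\<omega> \<in> paths S. f (\<omega> k) \<in> B}" "k \<in> T" "B \<in> sets N" by blast
  then have "{\<omega> \<in> paths S. shift c \<omega> \<in> A} = {\<omega> \<in> paths S. f (\<omega> (k + c)) \<in> B}" "k + c \<in> U" "B \<in> sets N"
    using assms(2) by (auto simp: shift_apply)
  then show ?case unfolding coord_field_def by (intro sigma_sets.Basic) blast
next
  case Empty
  then show ?case by (simp add: coord_field_def sigma_sets.Empty)
next
  case (Compl A)
  have "{\<omega> \<in> paths S. shift c \<omega> \<in> paths S - A} = paths S - {\<omega> \<in> paths S. shift c \<omega> \<in> A}" by auto
  then show ?case using Compl by (simp add: coord_field_def sigma_sets.Compl)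
next
  case (Union a)
  have "{\<omega> \<in> paths S. shift c \<omega> \<in> (\<Union>i. a i)} = (\<Union>i. {\<omega> \<in> paths S. shift c \<omega> \<in> a i})" by auto
  then show ?case using Union by (simp add: coord_field_def sigma_sets.Union)
qed

lemma sigma_algebra_coord_field: "sigma_algebra (paths S) (coord_field S f N T)"
  unfolding coord_field_def by (intro sigma_algebra_sigma_sets coord_gen_Pow)

lemma sigma_algebra_path_field: "sigma_algebra (paths S) (path_field S T)"
  unfolding path_field_def by (rule sigma_algebra_coord_field)

lemma measurable_shift:
  "(\<And>k. k \<in> T \<Longrightarrow> k + c \<in> U) \<Longrightarrow>
    shift c \<in> sigma (paths S) (path_field S U) \<rightarrow>\<^sub>M sigma (paths S) (path_field S T)"
  by (rule measurable_into_path_sigma)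
     (simp, simp add: shift_def[abs_def] measurable_coord)

text \<open>
  The \<open>\<sigma>\<close>-algebras of the past are generated by intersection-stable families on which the law of
  the chain is given by its initial distribution (time 0) or by one application of the kernel (later
  times). This is what proofs by induction on time rest on.
\<close>

lemma path_field_present:
  "path_field S {0..int 0} = sigma_sets (paths S) {{\<omega> \<in> paths S. \<omega> 0 \<in> A} | A. A \<in> sets S}"
  unfolding path_field_def coord_field_def by (intro arg_cong2[where f=sigma_sets] refl) auto

lemma Int_stable_path_field_present: "Int_stable {{\<omega> \<in> paths S. \<omega> 0 \<in> A} | A. A \<in> sets S}"
proof (rule Int_stableI, safe)
  fix A B assume "A \<in> sets S" "B \<in> sets S"
  then show "\<exists>C. {\<omega> \<in> paths S. \<omega> 0 \<in> A} \<inter> {\<omega> \<in> paths S. \<omega> 0 \<in> B} = {\<omega> \<in> paths S. \<omega> 0 \<in> C} \<and> C \<in> sets S"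
    by (intro exI[of _ "A \<inter> B"]) auto
qed

definition step_rectangles :: "'s measure \<Rightarrow> nat \<Rightarrow> (int \<Rightarrow> 's) set set" where
  "step_rectangles S n =
     {B \<inter> {\<omega> \<in> paths S. \<omega> (int n + 1) \<in> A} | B A. B \<in> path_field S {0..int n} \<and> A \<in> sets S}"

lemma path_field_Suc: "path_field S {0..int (Suc n)} = sigma_sets (paths S) (step_rectangles S n)"
proof
  interpret n: sigma_algebra "paths S" "path_field S {0..int n}" by (rule sigma_algebra_path_field)
  interpret Suc: sigma_algebra "paths S" "path_field S {0..int (Suc n)}" by (rule sigma_algebra_path_field)
  show "path_field S {0..int (Suc n)} \<subseteq> sigma_sets (paths S) (step_rectangles S n)"
    unfolding path_field_def[of S "{0..int (Suc n)}"] coord_field_def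
  proof (rule sigma_sets_mono, safe)
    fix k A assume k: "k \<in> {0..int (Suc n)}" and A: "A \<in> sets S"
    have "{\<omega> \<in> paths S. \<omega> k \<in> A} \<in> step_rectangles S n"
    proof (cases "k = int n + 1")
      case True
      then have "{\<omega> \<in> paths S. \<omega> k \<in> A} = paths S \<inter> {\<omega> \<in> paths S. \<omega> (int n + 1) \<in> A}" by auto
      then show ?thesis unfolding step_rectangles_def using A n.top by blast
    next
      case False
      have "{\<omega> \<in> paths S. \<omega> k \<in> A} = {\<omega> \<in> paths S. \<omega> k \<in> A} \<inter> {\<omega> \<in> paths S. \<omega> (int n + 1) \<in> space S}"
        by (auto simp: paths_def)
      moreover have "{\<omega> \<in> paths S. \<omega> k \<in> A} \<in> path_field S {0..int n}"
        using False k A by (intro coord_in_path_field) auto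
      ultimately show ?thesis unfolding step_rectangles_def by blast
    qed
    then show "{\<omega> \<in> paths S. \<omega> k \<in> A} \<in> sigma_sets (paths S) (step_rectangles S n)" by simp
  qed
  have "step_rectangles S n \<subseteq> path_field S {0..int (Suc n)}"
    unfolding step_rectangles_def using path_field_mono[of "{0..int n}" "{0..int (Suc n)}" S]
    by (auto intro!: Suc.Int[simplified] coord_in_path_field)
  then show "sigma_sets (paths S) (step_rectangles S n) \<subseteq> path_field S {0..int (Suc n)}"
    by (rule Suc.sigma_sets_subset)
qed

lemma Int_stable_step_rectangles: "Int_stable (step_rectangles S n)"
  unfolding step_rectangles_def
proof (rule Int_stableI, safe)
  interpret sigma_algebra "paths S" "path_field S {0..int n}" by (rule sigma_algebra_path_field)
  fix B A B' A'
  assume "B \<in> path_field S {0..int n}" "A \<in> sets S" "B' \<in> path_field S {0..int n}" "A' \<in> sets S"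
  then show "\<exists>B'' A''. B \<inter> {\<omega> \<in> paths S. \<omega> (int n + 1) \<in> A} \<inter> (B' \<inter> {\<omega> \<in> paths S. \<omega> (int n + 1) \<in> A'}) =
      B'' \<inter> {\<omega> \<in> paths S. \<omega> (int n + 1) \<in> A''} \<and> B'' \<in> path_field S {0..int n} \<and> A'' \<in> sets S"
    by (intro exI[of _ "B \<inter> B'"] exI[of _ "A \<inter> A'"]) auto
qed

lemma algebra_finite_past: "algebra (paths S) (\<Union>n::nat. path_field S {0..int n})"
proof (rule algebra_iff_Un[THEN iffD2], intro conjI ballI)
  show "(\<Union>n::nat. path_field S {0..int n}) \<subseteq> Pow (paths S)" by (auto dest: path_field_into_sp)
  have sa: "algebra (paths S) (path_field S {0..int n})" for n
    using sigma_algebra_path_field sigma_algebra_def by blast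
  show "{} \<in> (\<Union>n::nat. path_field S {0..int n})"
    using sa unfolding algebra_iff_Un by blast
  fix A assume "A \<in> (\<Union>n::nat. path_field S {0..int n})"
  then obtain n where A: "A \<in> path_field S {0..int n}" by blast
  show "paths S - A \<in> (\<Union>n::nat. path_field S {0..int n})"
    using sa[of n] A by (auto simp: algebra_iff_Un)
  fix B assume "B \<in> (\<Union>n::nat. path_field S {0..int n})"
  then obtain m where B: "B \<in> path_field S {0..int m}" by blast
  have "A \<in> path_field S {0..int (max n m)}" "B \<in> path_field S {0..int (max n m)}"
    using A B path_field_mono[of "{0..int n}" "{0..int (max n m)}" S]
      path_field_mono[of "{0..int m}" "{0..int (max n m)}" S] by auto
  then show "A \<union> B \<in> (\<Union>n::nat. path_field S {0..int n})"
    using sa[of "max n m"] unfolding algebra_iff_Un by blast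
qed

lemma path_field_future_eq_finite_past:
  "path_field S {0..} = sigma_sets (paths S) (\<Union>n::nat. path_field S {0..int n})"
proof
  interpret sigma_algebra "paths S" "path_field S {0..}" by (rule sigma_algebra_path_field)
  show "path_field S {0..} \<subseteq> sigma_sets (paths S) (\<Union>n::nat. path_field S {0..int n})"
    unfolding path_field_def[of S "{0..}"] coord_field_def
  proof (rule sigma_sets_mono, safe)
    fix k :: int and A assume "0 \<le> k" "A \<in> sets S"
    then have "{\<omega> \<in> paths S. \<omega> k \<in> A} \<in> path_field S {0..int (nat k)}"
      by (intro coord_in_path_field) auto
    then show "{\<omega> \<in> paths S. \<omega> k \<in> A} \<in> sigma_sets (paths S) (\<Union>n::nat. path_field S {0..int n})"
      by (intro sigma_sets.Basic) blast
  qed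
  show "sigma_sets (paths S) (\<Union>n::nat. path_field S {0..int n}) \<subseteq> path_field S {0..}"
    using path_field_mono[of "{0..int _}" "{0..}" S] by (intro sigma_sets_subset) fastforce
qed

lemma coord_field_subset_path_field:
  assumes "f \<in> S \<rightarrow>\<^sub>M N"
  shows "coord_field S f N T \<subseteq> path_field S T"
  unfolding path_field_def coord_field_def
proof (rule sigma_sets_mono, safe)
  fix k A assume k: "k \<in> T" and A: "A \<in> sets N"
  have "{\<omega> \<in> paths S. f (\<omega> k) \<in> A} = {\<omega> \<in> paths S. \<omega> k \<in> f -` A \<inter> space S}" by (auto simp: paths_def)
  then show "{\<omega> \<in> paths S. f (\<omega> k) \<in> A} \<in> sigma_sets (paths S) {{\<omega> \<in> paths S. \<omega> k \<in> A} |k A. k \<in> T \<and> A \<in> sets S}"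
    using k measurable_sets[OF assms A] by (intro sigma_sets.Basic) blast
qed

lemma coord_field_mono: "T \<subseteq> U \<Longrightarrow> coord_field S f N T \<subseteq> coord_field S f N U"
  unfolding coord_field_def by (intro sigma_sets_mono') auto

section \<open>Laws of Markov chains\<close>

text \<open>
  With nonnegative integrals the Markov property can be pushed through averages, conditioning and
  images without integrability side conditions.
\<close>

lemma (in markov_law_setup) is_markov_law_iff_emeasure:
  "is_markov_law S K \<mu> Q \<longleftrightarrow>
     prob_space Q \<and> space Q = paths S \<and> sets Q = path_field S {0..} \<and>
     distr Q S (\<lambda>\<omega>. \<omega> 0) = \<mu> \<and>
     (\<forall>n::nat. \<forall>A\<in>sets S. \<forall>B\<in>path_field S {0..int n}.
        emeasure Q (B \<inter> {\<omega> \<in> paths S. \<omega> (int n + 1) \<in> A})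
        = (\<integral>\<^sup>+\<omega>. indicator B \<omega> * emeasure (K (\<omega> (int n))) A \<partial>Q))"
proof -
  have "measure Q (B \<inter> {\<omega> \<in> paths S. \<omega> (int n + 1) \<in> A}) = (\<integral>\<omega>. indicator B \<omega> * measure (K (\<omega> (int n))) A \<partial>Q)
      \<longleftrightarrow> emeasure Q (B \<inter> {\<omega> \<in> paths S. \<omega> (int n + 1) \<in> A}) = (\<integral>\<^sup>+\<omega>. indicator B \<omega> * emeasure (K (\<omega> (int n))) A \<partial>Q)"
    if Q: "prob_space Q" "space Q = paths S" "sets Q = path_field S {0..}"
      and A: "A \<in> sets S" and B: "B \<in> path_field S {0..int n}" for Q A B n
  proof -
    interpret prob_space Q by fact
    have BQ: "B \<in> sets Q" using B path_field_mono[of "{0..int n}" "{0..}" S] by (auto simp: Q)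
    have Kn: "prob_space (K (\<omega> (int n)))" if "\<omega> \<in> space Q" for \<omega>
      using that by (intro K_prob) (auto simp: Q paths_def)
    have m: "(\<lambda>\<omega>. measure (K (\<omega> (int n))) A) \<in> borel_measurable Q"
      using measurable_K_coord[OF A, of "int n" "{0..}"] Q
      by (subst measurable_cong_sets[of Q "sigma (paths S) (path_field S {0..})" borel borel]) simp_all
    have "integrable Q (\<lambda>\<omega>. indicator B \<omega> * measure (K (\<omega> (int n))) A)"
      using m BQ Kn by (intro integrable_const_bound[of _ 1])
        (auto simp: indicator_def intro!: AE_I2 prob_space.prob_le_1)
    then have "(\<integral>\<^sup>+\<omega>. ennreal (indicator B \<omega> * measure (K (\<omega> (int n))) A) \<partial>Q)
        = ennreal (\<integral>\<omega>. indicator B \<omega> * measure (K (\<omega> (int n))) A \<partial>Q)"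
      by (intro nn_integral_eq_integral) auto
    moreover have "(\<integral>\<^sup>+\<omega>. ennreal (indicator B \<omega> * measure (K (\<omega> (int n))) A) \<partial>Q)
        = (\<integral>\<^sup>+\<omega>. indicator B \<omega> * emeasure (K (\<omega> (int n))) A \<partial>Q)"
    proof (rule nn_integral_cong)
      fix \<omega> assume "\<omega> \<in> space Q"
      then interpret k: prob_space "K (\<omega> (int n))" by (rule Kn)
      show "ennreal (indicator B \<omega> * measure (K (\<omega> (int n))) A) = indicator B \<omega> * emeasure (K (\<omega> (int n))) A"
        by (auto simp: k.emeasure_eq_measure split: split_indicator)
    qed
    ultimately show ?thesis
      by (simp add: emeasure_eq_measure ennreal_inj integral_nonneg_AE)
  qed
  then show ?thesis unfolding is_markov_law_iff by (intro conj_cong refl) blast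
qed

locale markov_kernel =
  fixes S :: "'s measure" and K :: "'s \<Rightarrow> 's measure"
  assumes kernel: "K \<in> S \<rightarrow>\<^sub>M prob_algebra S"
begin

abbreviation future :: "(int \<Rightarrow> 's) measure" where
  "future \<equiv> sigma (paths S) (path_field S {0..})"

abbreviation past :: "nat \<Rightarrow> (int \<Rightarrow> 's) measure" where
  "past n \<equiv> sigma (paths S) (path_field S {0..int n})"

lemma past_subset: "path_field S {0..int n} \<subseteq> path_field S {0..}"
  by (intro path_field_mono) auto

lemma chain_law_props:
  assumes \<mu>: "\<mu> \<in> space (prob_algebra S)"
  shows prob_space_chain_law: "prob_space (chain_law S K \<mu>)"
    and space_chain_law: "space (chain_law S K \<mu>) = paths S"
    and sets_chain_law: "sets (chain_law S K \<mu>) = path_field S {0..}"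
    and initial_chain_law: "distr (chain_law S K \<mu>) S (\<lambda>\<omega>. \<omega> 0) = \<mu>"
    and step_chain_law: "\<And>n A B. A \<in> sets S \<Longrightarrow> B \<in> path_field S {0..int n} \<Longrightarrow>
        emeasure (chain_law S K \<mu>) (B \<inter> {\<omega> \<in> paths S. \<omega> (int n + 1) \<in> A})
        = (\<integral>\<^sup>+\<omega>. indicator B \<omega> * emeasure (K (\<omega> (int n))) A \<partial>chain_law S K \<mu>)"
proof -
  interpret markov_law_setup S K \<mu> by standard (use kernel \<mu> in auto)
  have "is_markov_law S K \<mu> (chain_law S K \<mu>)"
    using is_markov_law_chain_law[OF kernel \<mu>] by blast
  note * = this[unfolded is_markov_law_iff_emeasure]
  show "prob_space (chain_law S K \<mu>)" "space (chain_law S K \<mu>) = paths S"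
    "sets (chain_law S K \<mu>) = path_field S {0..}" "distr (chain_law S K \<mu>) S (\<lambda>\<omega>. \<omega> 0) = \<mu>"
    using * by auto
  show "\<And>n A B. A \<in> sets S \<Longrightarrow> B \<in> path_field S {0..int n} \<Longrightarrow>
        emeasure (chain_law S K \<mu>) (B \<inter> {\<omega> \<in> paths S. \<omega> (int n + 1) \<in> A})
        = (\<integral>\<^sup>+\<omega>. indicator B \<omega> * emeasure (K (\<omega> (int n))) A \<partial>chain_law S K \<mu>)"
    using * by blast
qed

lemma measurable_from_chain_law:
  "\<mu> \<in> space (prob_algebra S) \<Longrightarrow> measurable (chain_law S K \<mu>) N = measurable future N"
  by (rule measurable_cong_sets) (simp_all add: sets_chain_law)

lemma return_in_prob_algebra: "x \<in> space S \<Longrightarrow> return S x \<in> space (prob_algebra S)"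
  by (auto simp: space_prob_algebra prob_space_return)

lemma measurable_step:
  assumes "A \<in> sets S" "B \<in> path_field S {0..int n}"
  shows "(\<lambda>\<omega>. indicator B \<omega> * emeasure (K (\<omega> (int n))) A) \<in> borel_measurable (past n)"
proof (intro borel_measurable_times_ennreal borel_measurable_indicator)
  show "(\<lambda>\<omega>. emeasure (K (\<omega> (int n))) A) \<in> borel_measurable (past n)"
    using assms(1) by (intro measurable_compose[OF measurable_coord[of "int n"]]
        measurable_emeasure_kernel[OF measurable_prob_algebraD[OF kernel]]) auto
qed (use assms in simp)

lemma measurable_step_future:
  assumes "A \<in> sets S" "B \<in> path_field S {0..int n}"
  shows "(\<lambda>\<omega>. indicator B \<omega> * emeasure (K (\<omega> (int n))) A) \<in> borel_measurable future"
  by (rule measurable_from_subalg[OF _ measurable_step[OF assms]])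
     (use past_subset in \<open>simp add: subalgebra_def\<close>)

text \<open>
  By induction on \<open>n\<close>: the probability of an event of \<open>step_rectangles S n\<close> is the integral, with
  respect to the law of the chain up to time \<open>n\<close>, of a function that does not depend on the
  starting point. Restricting the law to the past makes the induction hypothesis a statement about
  integrals of all functions of the past.
\<close>

lemma measurable_chain_law_past:
  "(\<lambda>x. restr_to_subalg (chain_law S K (return S x)) (past n)) \<in> S \<rightarrow>\<^sub>M prob_algebra (past n)"
proof (induction n)
  let ?L = "\<lambda>x. chain_law S K (return S x)"
  have sub: "subalgebra (?L x) (past n)" if "x \<in> space S" for x n
    using chain_law_props[OF return_in_prob_algebra[OF that]] past_subset by (simp add: subalgebra_def)
  have prob: "prob_space (restr_to_subalg (?L x) (past n))" if "x \<in> space S" for x n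
    using prob_space_restr_to_subalg[OF sub] chain_law_props(1)[OF return_in_prob_algebra] that by blast
  have sets: "sets (restr_to_subalg (?L x) (past n)) = sets (past n)" if "x \<in> space S" for x n
    by (simp add: sets_restr_to_subalg[OF sub[OF that]])
  {
    case 0
    show ?case
    proof (rule measurable_prob_algebra_generated[where N="past 0", OF _ Int_stable_path_field_present _ prob sets])
      show "sets (past 0) = sigma_sets (paths S) {{\<omega> \<in> paths S. \<omega> 0 \<in> A} | A. A \<in> sets S}"
        using path_field_present by simp
      fix C assume "C \<in> {{\<omega> \<in> paths S. \<omega> 0 \<in> A} | A. A \<in> sets S}"
      then obtain A where C: "C = {\<omega> \<in> paths S. \<omega> 0 \<in> A}" and A: "A \<in> sets S" by blast
      have "emeasure (restr_to_subalg (?L x) (past 0)) C = indicator A x" if "x \<in> space S" for x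
      proof -
        note L = chain_law_props[OF return_in_prob_algebra[OF that]]
        have "emeasure (restr_to_subalg (?L x) (past 0)) C = emeasure (?L x) C"
          using A by (intro emeasure_restr_to_subalg[OF sub[OF that]]) (auto simp: C intro: coord_in_path_field)
        also have "\<dots> = emeasure (distr (?L x) S (\<lambda>\<omega>. \<omega> 0)) A"
          using A L(2) measurable_from_chain_law[OF return_in_prob_algebra[OF that]]
          by (subst emeasure_distr)
            (auto simp: C intro!: arg_cong[where f="emeasure (?L x)"] measurable_coord)
        finally show ?thesis using L(4) A by simp
      qed
      then show "(\<lambda>x. emeasure (restr_to_subalg (?L x) (past 0)) C) \<in> borel_measurable S"
        using A by (subst measurable_cong) auto
    qed auto
  next
    case (Suc n)
    show ?case
    proof (rule measurable_prob_algebra_generated[where N="past (Suc n)", OF _ Int_stable_step_rectangles _ prob sets])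
      show "sets (past (Suc n)) = sigma_sets (paths S) (step_rectangles S n)"
        using path_field_Suc by simp
      fix C assume Crect: "C \<in> step_rectangles S n"
      then obtain A B where C: "C = B \<inter> {\<omega> \<in> paths S. \<omega> (int n + 1) \<in> A}"
        and A: "A \<in> sets S" and B: "B \<in> path_field S {0..int n}" by (auto simp: step_rectangles_def)
      have CSuc: "C \<in> path_field S {0..int (Suc n)}"
        unfolding path_field_Suc using Crect by (rule sigma_sets.Basic)
      have "emeasure (restr_to_subalg (?L x) (past (Suc n))) C =
          (\<integral>\<^sup>+\<omega>. indicator B \<omega> * emeasure (K (\<omega> (int n))) A \<partial>restr_to_subalg (?L x) (past n))"
        if "x \<in> space S" for x
      proof -
        note L = chain_law_props[OF return_in_prob_algebra[OF that]]
        have "emeasure (restr_to_subalg (?L x) (past (Suc n))) C = emeasure (?L x) C"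
          using CSuc by (intro emeasure_restr_to_subalg[OF sub[OF that]]) simp
        also have "\<dots> = (\<integral>\<^sup>+\<omega>. indicator B \<omega> * emeasure (K (\<omega> (int n))) A \<partial>?L x)"
          unfolding C by (rule L(5)[OF A B])
        finally show ?thesis
          using nn_integral_subalgebra2[OF sub[OF that] measurable_step[OF A B]] by simp
      qed
      moreover have "(\<lambda>x. \<integral>\<^sup>+\<omega>. indicator B \<omega> * emeasure (K (\<omega> (int n))) A \<partial>restr_to_subalg (?L x) (past n))
          \<in> borel_measurable S"
        by (rule measurable_compose[OF measurable_prob_algebraD[OF Suc.IH]
              nn_integral_measurable_subprob_algebra[OF measurable_step[OF A B]]])
      ultimately show "(\<lambda>x. emeasure (restr_to_subalg (?L x) (past (Suc n))) C) \<in> borel_measurable S"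
        by (subst measurable_cong) auto
    qed (auto simp: step_rectangles_def)
  }
qed

lemma measurable_chain_law: "(\<lambda>x. chain_law S K (return S x)) \<in> S \<rightarrow>\<^sub>M prob_algebra future"
proof (rule measurable_prob_algebra_generated[where \<Omega>="paths S" and G="\<Union>n::nat. path_field S {0..int n}"])
  let ?L = "\<lambda>x. chain_law S K (return S x)"
  show "sets future = sigma_sets (paths S) (\<Union>n::nat. path_field S {0..int n})"
    using path_field_future_eq_finite_past by simp
  show "Int_stable (\<Union>n::nat. path_field S {0..int n})"
    using algebra_finite_past[of S] by (simp add: Int_stable_def algebra_iff_Int)
  show "(\<Union>n::nat. path_field S {0..int n}) \<subseteq> Pow (paths S)" by (auto dest: path_field_into_sp)
  fix B assume "B \<in> (\<Union>n::nat. path_field S {0..int n})"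
  then obtain n where B: "B \<in> path_field S {0..int n}" by blast
  have "subalgebra (?L x) (past n)" if "x \<in> space S" for x
    using chain_law_props[OF return_in_prob_algebra[OF that]] past_subset by (simp add: subalgebra_def)
  then have "emeasure (restr_to_subalg (?L x) (past n)) B = emeasure (?L x) B" if "x \<in> space S" for x
    using that B by (intro emeasure_restr_to_subalg) auto
  moreover have "(\<lambda>x. emeasure (restr_to_subalg (?L x) (past n)) B) \<in> borel_measurable S"
    using B by (intro measurable_emeasure_kernel[OF measurable_prob_algebraD[OF measurable_chain_law_past]]) simp
  ultimately show "(\<lambda>x. emeasure (?L x) B) \<in> borel_measurable S" by (subst (asm) measurable_cong) auto
qed (auto simp: chain_law_props[OF return_in_prob_algebra])

text \<open>
  The Markov property is linear in the law of the chain, so the average over the starting point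
  inherits it.
\<close>

lemma chain_law_eq_bind:
  assumes \<mu>: "\<mu> \<in> space (prob_algebra S)"
  shows "chain_law S K \<mu> = \<mu> \<bind> (\<lambda>x. chain_law S K (return S x))"
proof -
  let ?L = "\<lambda>x. chain_law S K (return S x)"
  let ?Q = "\<mu> \<bind> ?L"
  interpret markov_law_setup S K \<mu> by standard (use kernel \<mu> in auto)
  interpret \<mu>: prob_space \<mu> using mu_props by simp
  have sp\<mu>: "space \<mu> = space S" using mu_props by (auto dest: sets_eq_imp_space_eq)
  have Lm: "?L \<in> \<mu> \<rightarrow>\<^sub>M subprob_algebra future"
    using measurable_prob_algebraD[OF measurable_chain_law] mu_props by (simp cong: measurable_cong_sets)
  have Q: "prob_space ?Q" "sets ?Q = path_field S {0..}"
    using prob_space_bind'[OF \<mu> measurable_chain_law] sets_bind'[OF \<mu> measurable_chain_law] by auto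
  then have spQ: "space ?Q = paths S" using sets_eq_imp_space_eq[of ?Q future] by simp
  have coord0: "(\<lambda>\<omega>. \<omega> 0) \<in> future \<rightarrow>\<^sub>M S" by (rule measurable_coord) simp
  have init: "distr ?Q S (\<lambda>\<omega>. \<omega> 0) = \<mu>"
  proof -
    have "distr ?Q S (\<lambda>\<omega>. \<omega> 0) = \<mu> \<bind> (\<lambda>x. distr (?L x) S (\<lambda>\<omega>. \<omega> 0))"
      by (rule distr_bind[OF Lm \<mu>.not_empty coord0])
    also have "\<dots> = \<mu> \<bind> return S"
      by (intro bind_cong refl) (simp add: sp\<mu> initial_chain_law[OF return_in_prob_algebra])
    also have "\<dots> = \<mu>" using mu_props by (intro bind_return'') simp
    finally show ?thesis .
  qed
  have step: "emeasure ?Q (B \<inter> {\<omega> \<in> paths S. \<omega> (int n + 1) \<in> A})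
      = (\<integral>\<^sup>+\<omega>. indicator B \<omega> * emeasure (K (\<omega> (int n))) A \<partial>?Q)"
    if A: "A \<in> sets S" and B: "B \<in> path_field S {0..int n}" for A B n
  proof -
    have "B \<inter> {\<omega> \<in> paths S. \<omega> (int n + 1) \<in> A} \<in> sets future"
      using A B past_subset[of n] by (intro sets.Int) (auto intro: coord_in_path_field)
    then have "emeasure ?Q (B \<inter> {\<omega> \<in> paths S. \<omega> (int n + 1) \<in> A}) =
        (\<integral>\<^sup>+x. emeasure (?L x) (B \<inter> {\<omega> \<in> paths S. \<omega> (int n + 1) \<in> A}) \<partial>\<mu>)"
      by (rule emeasure_bind_prob_algebra[OF \<mu> measurable_chain_law])
    also have "\<dots> = (\<integral>\<^sup>+x. \<integral>\<^sup>+\<omega>. indicator B \<omega> * emeasure (K (\<omega> (int n))) A \<partial>?L x \<partial>\<mu>)"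
      using A B by (intro nn_integral_cong) (simp add: sp\<mu> step_chain_law[OF return_in_prob_algebra])
    also have "\<dots> = (\<integral>\<^sup>+\<omega>. indicator B \<omega> * emeasure (K (\<omega> (int n))) A \<partial>?Q)"
      by (rule nn_integral_bind[OF measurable_step_future[OF A B] Lm, symmetric])
    finally show ?thesis .
  qed
  have "is_markov_law S K \<mu> ?Q"
    unfolding is_markov_law_iff_emeasure using Q spQ init step by blast
  then show ?thesis by (simp add: is_markov_law_chain_law[OF kernel \<mu>])
qed

lemma measure_chain_law_eq_integral:
  assumes \<mu>: "\<mu> \<in> space (prob_algebra S)" and A: "A \<in> path_field S {0..}"
  shows "measure (chain_law S K \<mu>) A = (\<integral>x. measure (chain_law S K (return S x)) A \<partial>\<mu>)"
proof -
  interpret \<mu>: prob_space \<mu> using \<mu> by (simp add: space_prob_algebra)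
  have "(\<lambda>x. chain_law S K (return S x)) \<in> \<mu> \<rightarrow>\<^sub>M subprob_algebra future"
    using measurable_prob_algebraD[OF measurable_chain_law] \<mu>
    by (simp add: space_prob_algebra cong: measurable_cong_sets)
  then show ?thesis unfolding chain_law_eq_bind[OF \<mu>] using A by (intro subprob_space.measure_bind[OF \<mu>.subprob_space_axioms]) auto
qed

text \<open>
  The Markov property at time \<open>n\<close>: conditioned on an event of the past, the future is again a chain
  with the same kernel. An event \<open>C\<close> of the shifted past of length \<open>m\<close>, together with \<open>B\<close>, is an event
  of the past of length \<open>m + n\<close>, so the Markov property of the original chain at time \<open>m + n\<close> is that
  of the shifted conditioned chain at time \<open>m\<close>.
\<close>

lemma markov_property:
  assumes \<mu>: "\<mu> \<in> space (prob_algebra S)" and B: "B \<in> path_field S {0..int n}"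
    and pos: "measure (chain_law S K \<mu>) B > 0"
  shows "\<exists>\<nu>\<in>space (prob_algebra S).
    distr (uniform_measure (chain_law S K \<mu>) B) future (shift (int n)) = chain_law S K \<nu>"
proof -
  let ?P = "chain_law S K \<mu>"
  let ?U = "uniform_measure ?P B"
  let ?Q = "distr ?U future (shift (int n))"
  let ?\<nu> = "distr ?Q S (\<lambda>\<omega>. \<omega> 0)"
  note P = chain_law_props[OF \<mu>]
  interpret P: prob_space ?P by (rule P)
  have BP: "B \<in> sets ?P" using B past_subset by (auto simp: P)
  have nz: "emeasure ?P B \<noteq> 0" "emeasure ?P B \<noteq> \<infinity>" using pos by (auto simp: P.emeasure_eq_measure)
  have "prob_space ?U" by (rule prob_space_uniform_measure[OF nz])
  then interpret U: prob_space ?U .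
  have shP: "shift (int n) \<in> ?P \<rightarrow>\<^sub>M future"
    unfolding measurable_from_chain_law[OF \<mu>] by (rule measurable_shift) simp
  then have shU: "shift (int n) \<in> ?U \<rightarrow>\<^sub>M future" by (simp cong: measurable_cong_sets)
  have Q: "prob_space ?Q" by (rule U.prob_space_distr[OF shU])
  have "(\<lambda>\<omega>. \<omega> 0) \<in> ?Q \<rightarrow>\<^sub>M S" by (simp add: measurable_coord)
  then have \<nu>: "?\<nu> \<in> space (prob_algebra S)"
    using prob_space.prob_space_distr[OF Q] by (simp add: space_prob_algebra)
  interpret markov_law_setup S K ?\<nu> by standard (use kernel \<nu> in auto)
  have step: "emeasure ?Q (C \<inter> {\<omega> \<in> paths S. \<omega> (int m + 1) \<in> A})
      = (\<integral>\<^sup>+\<omega>. indicator C \<omega> * emeasure (K (\<omega> (int m))) A \<partial>?Q)"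
    if A: "A \<in> sets S" and C: "C \<in> path_field S {0..int m}" for A C m
  proof -
    let ?C = "{\<omega> \<in> paths S. shift (int n) \<omega> \<in> C}"
    interpret mn: sigma_algebra "paths S" "path_field S {0..int (m + n)}" by (rule sigma_algebra_path_field)
    have "?C \<in> path_field S {0..int (m + n)}"
      using shift_vimage_coord_field[OF C[unfolded path_field_def], of "int n" "{0..int (m + n)}"]
      by (auto simp: path_field_def)
    moreover have "B \<in> path_field S {0..int (m + n)}"
      using B path_field_mono[of "{0..int n}" "{0..int (m + n)}" S] by auto
    ultimately have BC: "B \<inter> ?C \<in> path_field S {0..int (m + n)}" by (intro mn.Int)
    let ?D = "C \<inter> {\<omega> \<in> paths S. \<omega> (int m + 1) \<in> A}"
    have D: "?D \<in> path_field S {0..}"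
      using sets.Int[of C future "{\<omega> \<in> paths S. \<omega> (int m + 1) \<in> A}"] C A past_subset[of m]
        coord_in_path_field[of "int m + 1" "{0..}" A S] by auto
    have f: "(\<lambda>\<omega>. indicator C \<omega> * emeasure (K (\<omega> (int m))) A) \<in> borel_measurable future"
      by (rule measurable_step_future[OF A C])
    have "emeasure ?Q ?D = emeasure ?U (shift (int n) -` ?D \<inter> space ?U)"
      using D by (intro emeasure_distr[OF shU]) simp
    also have "\<dots> = emeasure ?P (B \<inter> (shift (int n) -` ?D \<inter> space ?U)) / emeasure ?P B"
      using measurable_sets[OF shP, of ?D] D BP by (intro emeasure_uniform_measure) auto
    also have "B \<inter> (shift (int n) -` ?D \<inter> space ?U) = (B \<inter> ?C) \<inter> {\<omega> \<in> paths S. \<omega> (int (m + n) + 1) \<in> A}"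
      using P(2) sets.sets_into_space[OF BP] by (auto simp: shift_apply add.commute add.left_commute)
    also have "emeasure ?P \<dots> = (\<integral>\<^sup>+\<omega>. indicator (B \<inter> ?C) \<omega> * emeasure (K (\<omega> (int (m + n)))) A \<partial>?P)"
      by (rule P(5)[OF A BC])
    also have "\<dots> = (\<integral>\<^sup>+\<omega>. (indicator C (shift (int n) \<omega>) * emeasure (K (shift (int n) \<omega> (int m))) A) * indicator B \<omega> \<partial>?P)"
      using P(2) by (intro nn_integral_cong) (auto simp: shift_apply split: split_indicator)
    also have "\<dots> / emeasure ?P B = (\<integral>\<^sup>+\<omega>. indicator C (shift (int n) \<omega>) * emeasure (K (shift (int n) \<omega> (int m))) A \<partial>?U)"
      by (rule nn_integral_uniform_measure[OF measurable_compose[OF shP f] BP, symmetric])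
    also have "\<dots> = (\<integral>\<^sup>+\<omega>. indicator C \<omega> * emeasure (K (\<omega> (int m))) A \<partial>?Q)"
      using f by (intro nn_integral_distr[OF shU, symmetric]) simp
    finally show ?thesis .
  qed
  have "is_markov_law S K ?\<nu> ?Q"
    unfolding is_markov_law_iff_emeasure using Q step by simp
  then show ?thesis using is_markov_law_chain_law[OF kernel \<nu>] \<nu> by blast
qed

end

section \<open>Tail events of an observable of the chain\<close>

definition tail_field :: "'s measure \<Rightarrow> ('s \<Rightarrow> 'b) \<Rightarrow> 'b measure \<Rightarrow> (int \<Rightarrow> 's) set set" where
  "tail_field S f N = (\<Inter>n::nat. coord_field S f N {int n..})"

lemma tail_field_subset_future:
  assumes "f \<in> S \<rightarrow>\<^sub>M N"
  shows "tail_field S f N \<subseteq> path_field S {0..}"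
proof -
  have "tail_field S f N \<subseteq> coord_field S f N {int 0..}"
    unfolding tail_field_def by (rule INT_lower) simp
  also have "\<dots> \<subseteq> path_field S {int 0..}" by (rule coord_field_subset_path_field[OF assms])
  finally show ?thesis by simp
qed

text \<open>
  Paths are indexed by all integers, so the shift is a bijection and a tail event can be moved to
  later and earlier times alike; that it can be moved arbitrarily far back is due to its not
  depending on any finite stretch of time.
\<close>

lemma shift_vimage_tail_field:
  assumes "A \<in> tail_field S f N"
  shows "{\<omega> \<in> paths S. shift (- int n) \<omega> \<in> A} \<in> tail_field S f N"
  unfolding tail_field_def
proof
  fix m
  have "A \<in> coord_field S f N {int (m + n)..}" using assms unfolding tail_field_def by blast
  then show "{\<omega> \<in> paths S. shift (- int n) \<omega> \<in> A} \<in> coord_field S f N {int m..}"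
    by (rule shift_vimage_coord_field) auto
qed

context markov_kernel
begin

text \<open>
  Taking the preimage under the inverse shift turns \<open>A\<close>, seen from time \<open>n\<close>, into an event seen from
  time 0, so that the Markov property applies. The product form includes the case that \<open>B\<close> is null.
\<close>

lemma conditional_prob_tail_event:
  assumes f: "f \<in> S \<rightarrow>\<^sub>M N" and \<mu>: "\<mu> \<in> space (prob_algebra S)"
    and A: "A \<in> tail_field S f N" and B: "B \<in> path_field S {0..int n}"
  shows "\<exists>\<nu>\<in>space (prob_algebra S). measure (chain_law S K \<mu>) (A \<inter> B) =
    measure (chain_law S K \<mu>) B * measure (chain_law S K \<nu>) {\<omega> \<in> paths S. shift (- int n) \<omega> \<in> A}"
proof -
  let ?P = "chain_law S K \<mu>"
  note P = chain_law_props[OF \<mu>]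
  interpret P: prob_space ?P by (rule P)
  have AP: "A \<in> sets ?P" using tail_field_subset_future[OF f] A by (auto simp: P)
  have BP: "B \<in> sets ?P" using B past_subset by (auto simp: P)
  show ?thesis
  proof (cases "P.prob B > 0")
    case True
    let ?U = "uniform_measure ?P B"
    let ?A = "{\<omega> \<in> paths S. shift (- int n) \<omega> \<in> A}"
    obtain \<nu> where \<nu>: "\<nu> \<in> space (prob_algebra S)" "distr ?U future (shift (int n)) = chain_law S K \<nu>"
      using markov_property[OF \<mu> B True] by blast
    have shU: "shift (int n) \<in> ?U \<rightarrow>\<^sub>M future"
      using measurable_from_chain_law[OF \<mu>, of future] measurable_shift[of "{0..}" "int n" "{0..}" S]
      by (simp add: measurable_cong_sets[of ?U ?P future future])
    have "?A \<in> path_field S {0..}"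
      using shift_vimage_tail_field[OF A] tail_field_subset_future[OF f] by blast
    then have "measure (chain_law S K \<nu>) ?A = measure ?U (shift (int n) -` ?A \<inter> space ?U)"
      unfolding \<nu>(2)[symmetric] by (intro measure_distr[OF shU]) simp
    also have "shift (int n) -` ?A \<inter> space ?U = A"
      using sets.sets_into_space[OF AP] P(2) by auto
    also have "measure ?U A = P.prob (B \<inter> A) / P.prob B"
      using True AP by (intro measure_uniform_measure) (auto simp: P.emeasure_eq_measure)
    finally show ?thesis using True by (intro bexI[OF _ \<nu>(1)]) (simp add: Int_commute)
  next
    case False
    then have B0: "P.prob B = 0" using zero_less_measure_iff[of ?P B] by blast
    have "P.prob (A \<inter> B) \<le> P.prob B" using BP by (intro P.finite_measure_mono) auto
    then have "P.prob (A \<inter> B) = 0" using B0 measure_nonneg[of ?P "A \<inter> B"] by linarith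
    with B0 show ?thesis using \<mu> by auto
  qed
qed

text \<open>
  The bound survives averaging \<open>x\<close> over \<open>\<mu>\<close> for each fixed \<open>y\<close>, and then averaging \<open>y\<close> over \<open>\<nu>\<close>.
\<close>

lemma tail_prob_diff_le:
  assumes c: "\<And>x y. x \<in> space S \<Longrightarrow> y \<in> space S \<Longrightarrow>
      measure (chain_law S K (return S x)) A - measure (chain_law S K (return S y)) A \<le> c"
    and A: "A \<in> path_field S {0..}"
    and \<mu>: "\<mu> \<in> space (prob_algebra S)" and \<nu>: "\<nu> \<in> space (prob_algebra S)"
  shows "measure (chain_law S K \<mu>) A - measure (chain_law S K \<nu>) A \<le> c"
proof -
  let ?p = "\<lambda>x. measure (chain_law S K (return S x)) A"
  have p: "?p \<in> borel_measurable S"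
    using A by (intro measurable_compose[OF measurable_chain_law measurable_measure_prob_algebra]) simp
  have int: "integrable \<rho> ?p" and prob: "prob_space \<rho>" and sp: "space \<rho> = space S"
    if \<rho>: "\<rho> \<in> space (prob_algebra S)" for \<rho>
  proof -
    show "prob_space \<rho>" using \<rho> by (simp add: space_prob_algebra)
    then interpret prob_space \<rho> .
    have s: "sets \<rho> = sets S" using \<rho> by (simp add: space_prob_algebra)
    then show sp: "space \<rho> = space S" by (rule sets_eq_imp_space_eq)
    show "integrable \<rho> ?p"
    proof (rule integrable_const_bound[of _ 1])
      show "AE x in \<rho>. norm (?p x) \<le> 1"
        by (auto simp: sp intro!: AE_I2 prob_space.prob_le_1 chain_law_props return_in_prob_algebra)
      show "?p \<in> borel_measurable \<rho>" using p measurable_cong_sets[OF s refl] by blast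
    qed
  qed
  interpret \<mu>: prob_space \<mu> by (rule prob[OF \<mu>])
  interpret \<nu>: prob_space \<nu> by (rule prob[OF \<nu>])
  have "measure (chain_law S K \<mu>) A \<le> ?p y + c" if "y \<in> space S" for y
  proof -
    have "measure (chain_law S K \<mu>) A \<le> (\<integral>x. ?p y + c \<partial>\<mu>)"
      unfolding measure_chain_law_eq_integral[OF \<mu> A]
      using c that by (intro integral_mono int \<mu>) (force simp: sp[OF \<mu>])+
    then show ?thesis by (simp add: \<mu>.prob_space)
  qed
  then have "(\<integral>y. measure (chain_law S K \<mu>) A - c \<partial>\<nu>) \<le> (\<integral>y. ?p y \<partial>\<nu>)"
    by (intro integral_mono int \<nu>) (force simp: sp[OF \<nu>])+
  then show ?thesis by (simp add: \<nu>.prob_space measure_chain_law_eq_integral[OF \<nu> A])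
qed

text \<open>
  The time \<open>n\<close> of the overlap may depend on the two starting points: a tail event belongs to the
  \<open>\<sigma>\<close>-algebras of all times, and on tail events the bound is uniform.
\<close>

lemma tail_trivial_if_uniformly_overlapping:
  assumes f: "f \<in> S \<rightarrow>\<^sub>M N" and \<alpha>: "\<alpha> > 0"
    and overlap: "\<And>x y. x \<in> space S \<Longrightarrow> y \<in> space S \<Longrightarrow> \<exists>n::nat.
      tv_dist (coord_field S f N {int n..}) (chain_law S K (return S x)) (chain_law S K (return S y)) \<le> 2 - \<alpha>"
    and \<mu>: "\<mu> \<in> space (prob_algebra S)" and A: "A \<in> tail_field S f N"
  shows "measure (chain_law S K \<mu>) A \<in> {0, 1}"
proof -
  let ?P = "chain_law S K \<mu>"
  note P = chain_law_props[OF \<mu>]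
  interpret P: prob_space ?P by (rule P)
  have gap: "measure (chain_law S K \<nu>) C - measure (chain_law S K \<nu>') C \<le> 1 - \<alpha> / 2"
    if C: "C \<in> tail_field S f N" and "\<nu> \<in> space (prob_algebra S)" "\<nu>' \<in> space (prob_algebra S)" for C \<nu> \<nu>'
  proof (rule tail_prob_diff_le)
    fix x y assume xy: "x \<in> space S" "y \<in> space S"
    then obtain n :: nat where n: "tv_dist (coord_field S f N {int n..})
        (chain_law S K (return S x)) (chain_law S K (return S y)) \<le> 2 - \<alpha>"
      using overlap by blast
    have "C \<in> coord_field S f N {int n..}" using C by (auto simp: tail_field_def)
    from abs_prob_diff_le_tv_dist[OF _ _ this, of "chain_law S K (return S x)" "chain_law S K (return S y)"] n xy
    show "measure (chain_law S K (return S x)) C - measure (chain_law S K (return S y)) C \<le> 1 - \<alpha> / 2"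
      by (simp add: prob_space_chain_law return_in_prob_algebra) argo
  qed (use that tail_field_subset_future[OF f] in auto)
  show ?thesis
  proof (rule P.trivial_if_contracting)
    show "algebra (space ?P) (\<Union>n::nat. path_field S {0..int n})"
      unfolding P(2) by (rule algebra_finite_past)
    show "sets ?P = sigma_sets (space ?P) (\<Union>n::nat. path_field S {0..int n})"
      unfolding P(2,3) by (rule path_field_future_eq_finite_past)
    show "A \<in> sets ?P" using A tail_field_subset_future[OF f] by (auto simp: P)
    show "1 - \<alpha> / 2 < 1" using \<alpha> by simp
    fix B assume "B \<in> (\<Union>n::nat. path_field S {0..int n})"
    then obtain n where B: "B \<in> path_field S {0..int n}" by blast
    interpret n: sigma_algebra "paths S" "path_field S {0..int n}" by (rule sigma_algebra_path_field)
    let ?B' = "space ?P - B"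
    have B': "?B' \<in> path_field S {0..int n}" using B P(2) by auto
    let ?A = "{\<omega> \<in> paths S. shift (- int n) \<omega> \<in> A}"
    obtain \<nu> where \<nu>: "\<nu> \<in> space (prob_algebra S)"
      "P.prob (A \<inter> B) = P.prob B * measure (chain_law S K \<nu>) ?A"
      using conditional_prob_tail_event[OF f \<mu> A B] by blast
    obtain \<nu>' where \<nu>': "\<nu>' \<in> space (prob_algebra S)"
      "P.prob (A \<inter> ?B') = P.prob ?B' * measure (chain_law S K \<nu>') ?A"
      using conditional_prob_tail_event[OF f \<mu> A B'] by blast
    have "P.prob (A \<inter> B) * P.prob ?B' - P.prob (A \<inter> ?B') * P.prob B =
        (measure (chain_law S K \<nu>) ?A - measure (chain_law S K \<nu>') ?A) * (P.prob B * P.prob ?B')"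
      unfolding \<nu>(2) \<nu>'(2) by (simp add: algebra_simps)
    also have "\<dots> \<le> (1 - \<alpha> / 2) * (P.prob B * P.prob ?B')"
      by (intro mult_right_mono gap shift_vimage_tail_field A \<nu> \<nu>') auto
    finally show "P.prob (A \<inter> B) * P.prob ?B' - P.prob (A \<inter> ?B') * P.prob B
        \<le> (1 - \<alpha> / 2) * (P.prob B * P.prob ?B')" .
  qed
qed

text \<open>
  The initial law is drawn from \<open>\<mu>\<close> or \<open>\<nu>\<close> by tossing a fair coin.
\<close>

lemma chain_law_half_mixture:
  assumes \<mu>: "\<mu> \<in> space (prob_algebra S)" and \<nu>: "\<nu> \<in> space (prob_algebra S)"
  shows "\<exists>\<rho>\<in>space (prob_algebra S). \<forall>A\<in>path_field S {0..}.
    measure (chain_law S K \<rho>) A = (measure (chain_law S K \<mu>) A + measure (chain_law S K \<nu>) A) / 2"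
proof -
  let ?b = "measure_pmf (bernoulli_pmf (1/2))"
  let ?m = "\<lambda>b. if b then \<mu> else \<nu>"
  let ?\<rho> = "?b \<bind> ?m"
  have b: "?b \<in> space (prob_algebra (count_space UNIV))"
    by (simp add: space_prob_algebra measure_pmf.prob_space_axioms)
  have m: "?m \<in> count_space UNIV \<rightarrow>\<^sub>M prob_algebra S" using \<mu> \<nu> by auto
  have \<rho>: "?\<rho> \<in> space (prob_algebra S)"
    using prob_space_bind'[OF b m] sets_bind'[OF b m] by (simp add: space_prob_algebra)
  have "measure (chain_law S K ?\<rho>) A = (measure (chain_law S K \<mu>) A + measure (chain_law S K \<nu>) A) / 2"
    if A: "A \<in> path_field S {0..}" for A
  proof -
    let ?p = "\<lambda>x. measure (chain_law S K (return S x)) A"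
    have "measure (chain_law S K ?\<rho>) A = (\<integral>x. ?p x \<partial>?\<rho>)"
      by (rule measure_chain_law_eq_integral[OF \<rho> A])
    also have "\<dots> = (\<integral>b. (\<integral>x. ?p x \<partial>?m b) \<partial>?b)"
    proof (rule integral_bind)
      show "?p \<in> borel_measurable S"
        using A by (intro measurable_compose[OF measurable_chain_law measurable_measure_prob_algebra]) simp
      show "\<bar>?p x\<bar> \<le> 1" if "x \<in> space S" for x
        using that by (auto intro!: prob_space.prob_le_1 chain_law_props return_in_prob_algebra)
      show "?m \<in> ?b \<rightarrow>\<^sub>M subprob_algebra S"
        using measurable_prob_algebraD[OF m] by (simp cong: measurable_cong_sets)
      show "finite_measure ?b" by (rule measure_pmf.finite_measure_axioms)
      show "AE b in ?b. emeasure (?m b) (space (?m b)) \<le> ennreal 1"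
        using \<mu> \<nu> by (auto simp: space_prob_algebra prob_space.emeasure_space_1)
    qed
    also have "\<dots> = (measure (chain_law S K \<mu>) A + measure (chain_law S K \<nu>) A) / 2"
      using measure_chain_law_eq_integral[OF \<mu> A] measure_chain_law_eq_integral[OF \<nu> A]
      by (simp add: integral_measure_pmf[of UNIV] UNIV_bool)
    finally show ?thesis .
  qed
  with \<rho> show ?thesis by blast
qed

text \<open>
  Triviality for the mixture is what rules out that the two chains give a tail event the
  probabilities 0 and 1, since then the mixture would give it 1/2.
\<close>

lemma mixing_if_tail_trivial:
  assumes f: "f \<in> S \<rightarrow>\<^sub>M N"
    and trivial: "\<And>\<rho> A. \<rho> \<in> space (prob_algebra S) \<Longrightarrow> A \<in> tail_field S f N \<Longrightarrow>
      measure (chain_law S K \<rho>) A \<in> {0, 1}"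
    and \<mu>: "\<mu> \<in> space (prob_algebra S)" and \<nu>: "\<nu> \<in> space (prob_algebra S)"
  shows "(\<lambda>n::nat. tv_dist (coord_field S f N {int n..}) (chain_law S K \<mu>) (chain_law S K \<nu>)) \<longlonglongrightarrow> 0"
proof -
  have sub: "coord_field S f N {int n..} \<subseteq> path_field S {0..}" for n
    using coord_field_subset_path_field[OF f, of "{int n..}"] path_field_mono[of "{int n..}" "{0..}" S]
    by auto
  have "\<exists>A\<in>\<Inter>n. coord_field S f N {int n..}.
      (\<lambda>n. tv_dist (coord_field S f N {int n..}) (chain_law S K \<mu>) (chain_law S K \<nu>))
        \<longlonglongrightarrow> 2 * (measure (chain_law S K \<mu>) A - measure (chain_law S K \<nu>) A)"
  proof (rule tv_dist_tail_attained[where \<Omega>="paths S"])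
    show "decseq (\<lambda>n::nat. coord_field S f N {int n..})"
      by (auto simp: decseq_def intro!: coord_field_mono)
  qed (use sub in \<open>auto simp: chain_law_props[OF \<mu>] chain_law_props[OF \<nu>] sigma_algebra_coord_field\<close>)
  then obtain A where A: "A \<in> tail_field S f N" and
    lim: "(\<lambda>n. tv_dist (coord_field S f N {int n..}) (chain_law S K \<mu>) (chain_law S K \<nu>))
        \<longlonglongrightarrow> 2 * (measure (chain_law S K \<mu>) A - measure (chain_law S K \<nu>) A)"
    unfolding tail_field_def by blast
  obtain \<rho> where \<rho>: "\<rho> \<in> space (prob_algebra S)"
    "measure (chain_law S K \<rho>) A = (measure (chain_law S K \<mu>) A + measure (chain_law S K \<nu>) A) / 2"
    using chain_law_half_mixture[OF \<mu> \<nu>] A tail_field_subset_future[OF f] by blast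
  have "measure (chain_law S K \<mu>) A = measure (chain_law S K \<nu>) A"
    using trivial[OF \<mu> A] trivial[OF \<nu> A] trivial[OF \<rho>(1) A] \<rho>(2) by auto
  with lim show ?thesis by simp
qed

end

section \<open>Local mixing\<close>

lemma local_tail_field_eq_tail_field:
  "local_tail_field M S J = tail_field S (\<lambda>x. restrict x J) (\<Pi>\<^sub>M i\<in>J. M i)"
  by (simp add: local_tail_field_def tail_field_def local_field_def)

lemma measurable_restrict_state_space:
  assumes "J \<subseteq> I"
  shows "(\<lambda>x. restrict x J) \<in> state_space I M E \<rightarrow>\<^sub>M (\<Pi>\<^sub>M i\<in>J. M i)"
  unfolding state_space_def by (intro measurable_restrict_space1 measurable_restrict_subset assms)

theorem corollary2p5:
  fixes I :: "'i set" and M :: "'i \<Rightarrow> 'a measure" and E :: "('i \<Rightarrow> 'a) set"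
    and S :: "('i \<Rightarrow> 'a) measure" and P :: "('i \<Rightarrow> 'a) \<Rightarrow> ('i \<Rightarrow> 'a) measure"
  assumes "countable I"
    and "E \<subseteq> space (\<Pi>\<^sub>M i\<in>I. M i)"
    and "S = state_space I M E"
    and "P \<in> S \<rightarrow>\<^sub>M prob_algebra S"
  shows
    "(locally_mixing I M S P \<longleftrightarrow>
       (\<forall>\<mu>\<in>space (prob_algebra S). \<forall>A\<in>A_loc I M S. measure (chain_law S P \<mu>) A \<in> {0, 1})) \<and>
     (locally_mixing I M S P \<longleftrightarrow>
       (\<forall>J. J \<subseteq> I \<and> finite J \<longrightarrow>
         (\<exists>\<alpha>>0. \<forall>x\<in>E. \<forall>x'\<in>E. \<exists>n::nat.
           tv_dist (local_field M S J {int n..})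
             (chain_law S P (return S x)) (chain_law S P (return S x')) \<le> 2 - \<alpha>)))"
    (is "(?mixing \<longleftrightarrow> ?trivial) \<and> (?mixing \<longleftrightarrow> ?overlap)")
proof -
  interpret markov_kernel S P by standard fact
  have spS: "space S = E" using assms(2,3) by (auto simp: state_space_def space_restrict_space)
  have restr: "(\<lambda>x. restrict x J) \<in> S \<rightarrow>\<^sub>M (\<Pi>\<^sub>M i\<in>J. M i)" if "J \<subseteq> I" for J
    unfolding assms(3) using that by (rule measurable_restrict_state_space)
  have overlap: ?overlap if ?mixing
  proof (intro allI impI exI[of _ "1::real"] conjI ballI)
    fix J x x' assume J: "J \<subseteq> I \<and> finite J" and x: "x \<in> E" "x' \<in> E"
    have "(\<lambda>n::nat. tv_dist (local_field M S J {int n..})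
        (chain_law S P (return S x)) (chain_law S P (return S x'))) \<longlonglongrightarrow> 0"
      using that J x return_in_prob_algebra unfolding locally_mixing_def spS by blast
    then have "\<forall>\<^sub>F n::nat in sequentially. tv_dist (local_field M S J {int n..})
        (chain_law S P (return S x)) (chain_law S P (return S x')) < 1"
      by (rule order_tendstoD) simp
    then show "\<exists>n::nat. tv_dist (local_field M S J {int n..})
        (chain_law S P (return S x)) (chain_law S P (return S x')) \<le> 2 - 1"
      by (auto simp: eventually_sequentially intro: less_imp_le)
  qed simp
  have trivial: ?trivial if overlap: ?overlap
  proof (intro ballI)
    fix \<mu> A assume \<mu>: "\<mu> \<in> space (prob_algebra S)" and A: "A \<in> A_loc I M S"
    let ?G = "\<Union>J\<in>{J. J \<subseteq> I \<and> finite J}. local_tail_field M S J"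
    interpret prob_space "chain_law S P \<mu>" by (rule prob_space_chain_law[OF \<mu>])
    show "prob A \<in> {0, 1}"
    proof (rule trivial_sigma_sets[of ?G])
      show "?G \<subseteq> sets (chain_law S P \<mu>)"
        unfolding local_tail_field_eq_tail_field sets_chain_law[OF \<mu>]
        by (intro UN_least tail_field_subset_future restr) simp
      show "A \<in> sigma_sets (space (chain_law S P \<mu>)) ?G"
        using A by (simp add: A_loc_def space_chain_law[OF \<mu>])
      fix B assume "B \<in> ?G"
      then obtain J where J: "J \<subseteq> I" "finite J"
        and B: "B \<in> tail_field S (\<lambda>x. restrict x J) (\<Pi>\<^sub>M i\<in>J. M i)"
        unfolding local_tail_field_eq_tail_field by blast
      obtain \<alpha> where "\<alpha> > 0" "\<And>x x'. x \<in> space S \<Longrightarrow> x' \<in> space S \<Longrightarrow> \<exists>n::nat.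
          tv_dist (coord_field S (\<lambda>x. restrict x J) (\<Pi>\<^sub>M i\<in>J. M i) {int n..})
            (chain_law S P (return S x)) (chain_law S P (return S x')) \<le> 2 - \<alpha>"
        using overlap J unfolding local_field_def spS by meson
      then show "prob B \<in> {0, 1}"
        by (intro tail_trivial_if_uniformly_overlapping[OF restr[OF J(1)] _ _ \<mu> B])
    qed
  qed
  have mixing: ?mixing if ?trivial
    unfolding locally_mixing_def
  proof (intro ballI allI impI)
    fix \<mu> \<nu> J assume \<mu>: "\<mu> \<in> space (prob_algebra S)" and \<nu>: "\<nu> \<in> space (prob_algebra S)"
      and J: "J \<subseteq> I \<and> finite J"
    have "local_tail_field M S J \<subseteq> A_loc I M S"
      unfolding A_loc_def using J by (auto intro!: sigma_sets.Basic)
    then show "(\<lambda>n::nat. tv_dist (local_field M S J {int n..}) (chain_law S P \<mu>) (chain_law S P \<nu>)) \<longlonglongrightarrow> 0"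
      unfolding local_field_def using that J
      by (intro mixing_if_tail_trivial[OF restr _ \<mu> \<nu>]) (auto simp: local_tail_field_eq_tail_field)
  qed
  show ?thesis using overlap trivial mixing by blast
qed

end
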